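(* Let $\Bbbk$ be a field and let $m\ge2$ and $0\le d<m$ be integers. There exists a monomial ideal $K$ in $R=\Bbbk[x,y,z,u,v]$ such that for all $t\ge1$, $$\operatorname{depth} R/K^{(t)}=\begin{cases}2&\text{if } t\equiv d \pmod m,\\ 1&\text{otherwise.}\end{cases}$$
   Context: For an ideal $Q$ in a Noetherian ring $S$ and $t\ge0$, the $t$-th symbolic power is $Q^{(t)}=\bigcap_{\mathfrak p\in\operatorname{Min}(Q)}(Q^t S_{\mathfrak p}\cap S)$, where $\operatorname{Min}(Q)$ is the set of minimal primes of $Q$. Depth is taken with respect to the maximal homogeneous ideal. *)

theory Defs
  imports Main "HOL-Library.Poly_Mapping" "HOL-Library.Numeral_Type" "HOL-Library.Extended_Nat"
begin

text \<open>The polynomial ring R = k[x,y,z,u,v]: polynomials in the five variables indexed by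
  the type 5 (x,y,z,u,v correspond to 0,1,2,3,4), represented as finitely supported maps
  from exponent vectors to coefficients.\<close>
type_synonym 'k poly5 = "(5 \<Rightarrow>\<^sub>0 nat) \<Rightarrow>\<^sub>0 'k"

definition var5 :: "5 \<Rightarrow> 'k::field poly5" where
  "var5 i = Poly_Mapping.single (Poly_Mapping.single i 1) 1"

definition monom5 :: "(5 \<Rightarrow>\<^sub>0 nat) \<Rightarrow> 'k::field poly5" where
  "monom5 a = Poly_Mapping.single a 1"

definition is_ideal :: "'a::comm_ring_1 set \<Rightarrow> bool" where
  "is_ideal I \<longleftrightarrow> 0 \<in> I \<and> (\<forall>a\<in>I. \<forall>b\<in>I. a + b \<in> I) \<and> (\<forall>r. \<forall>a\<in>I. r * a \<in> I)"

definition ideal_gen :: "'a::comm_ring_1 set \<Rightarrow> 'a set" where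
  "ideal_gen S = \<Inter>{I. is_ideal I \<and> S \<subseteq> I}"

definition ideal_pow :: "'a::comm_ring_1 set \<Rightarrow> nat \<Rightarrow> 'a set" where
  "ideal_pow I t = ideal_gen {prod_list xs | xs. length xs = t \<and> set xs \<subseteq> I}"

definition is_prime_ideal :: "'a::comm_ring_1 set \<Rightarrow> bool" where
  "is_prime_ideal P \<longleftrightarrow> is_ideal P \<and> P \<noteq> UNIV \<and> (\<forall>a b. a * b \<in> P \<longrightarrow> a \<in> P \<or> b \<in> P)"

definition min_primes :: "'a::comm_ring_1 set \<Rightarrow> 'a set set" where
  "min_primes Q = {P. is_prime_ideal P \<and> Q \<subseteq> P \<and>
      (\<forall>P'. is_prime_ideal P' \<and> Q \<subseteq> P' \<and> P' \<subseteq> P \<longrightarrow> P' = P)}"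

text \<open>Contraction J S_P \<inter> S of the extension of J to the localization at the prime P.\<close>
definition loc_contract :: "'a::comm_ring_1 set \<Rightarrow> 'a set \<Rightarrow> 'a set" where
  "loc_contract J P = {f. \<exists>s. s \<notin> P \<and> s * f \<in> J}"

definition symbolic_power :: "'a::comm_ring_1 set \<Rightarrow> nat \<Rightarrow> 'a set" where
  "symbolic_power Q t = (\<Inter>P\<in>min_primes Q. loc_contract (ideal_pow Q t) P)"

definition monomial_ideal :: "'k::field poly5 set \<Rightarrow> bool" where
  "monomial_ideal K \<longleftrightarrow> (\<exists>A. K = ideal_gen (monom5 ` A))"

definition max_hom :: "'k::field poly5 set" where
  "max_hom = ideal_gen (range var5)"

definition regular_seq :: "'k::field poly5 set \<Rightarrow> 'k poly5 list \<Rightarrow> bool" where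
  "regular_seq I fs \<longleftrightarrow> set fs \<subseteq> max_hom \<and>
     (\<forall>i < length fs. \<forall>g. fs ! i * g \<in> ideal_gen (I \<union> set (take i fs))
                          \<longrightarrow> g \<in> ideal_gen (I \<union> set (take i fs))) \<and>
     ideal_gen (I \<union> set fs) \<noteq> UNIV"

definition depth_quot :: "'k::field poly5 set \<Rightarrow> enat" where
  "depth_quot I = (SUP fs \<in> {fs. regular_seq I fs}. enat (length fs))"

end

theory Submission
  imports Defs
begin

text \<open>The ideal \<open>K\<close> is the intersection of three monomial ideals \<open>A\<close>, \<open>B\<close>, \<open>C\<close>, primary to
  \<open>(y, z, u)\<close>, \<open>(x, z, v)\<close> and \<open>(x, y, z)\<close>, so its symbolic powers are \<open>A\<^sup>t \<inter> B\<^sup>t \<inter> C\<^sup>t\<close>. The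
  zero sets of \<open>A\<close> and \<open>B\<close> meet only in the origin and are connected through that of \<open>C\<close>. Hence the
  depth is 2 if \<open>C\<^sup>t \<subseteq> A\<^sup>t \<union> B\<^sup>t\<close> holds for monomials, and 1 otherwise.

  Take \<open>A = (y^(2m), z^2, u)\<close> and \<open>B = (x^(2m), z^2, v)\<close>, and let \<open>C\<close> be generated by high powers of
  \<open>x, y, z\<close> and by \<open>g1 = x^(m+1) y^(3m-1)\<close>, \<open>g2 = x^(2m+1) y^(2m-1)\<close> and
  \<open>g3 = x^(2m+1-D) y^(m+D-1) z\<close>. A monomial of \<open>C\<^sup>t\<close> outside \<open>A\<^sup>t \<union> B\<^sup>t\<close> must come from \<open>g1^i g2^k g3\<close>
  with \<open>i + k + 1 = t\<close>: without \<open>g3\<close> the degree in \<open>x, y\<close> is too large, and two factors \<open>g3\<close> produce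
  \<open>z^2\<close>. The remaining bounds on the degrees in \<open>x\<close> and in \<open>y\<close> say that \<open>k - (m - 1) i = t - 1 - m i\<close>
  lies in a window of \<open>m - 1\<close> consecutive integers, whose position is determined by \<open>D\<close>; so exactly
  one residue class of \<open>t\<close> modulo \<open>m\<close> is missed.\<close>

section \<open>Ideals, regular elements and regular sequences\<close>

lemma is_idealD:
  assumes "is_ideal I"
  shows is_ideal_zero: "0 \<in> I"
    and is_ideal_add: "a \<in> I \<Longrightarrow> b \<in> I \<Longrightarrow> a + b \<in> I"
    and is_ideal_mult: "a \<in> I \<Longrightarrow> r * a \<in> I"
    and is_ideal_mult_right: "a \<in> I \<Longrightarrow> a * r \<in> I"
    and is_ideal_uminus: "a \<in> I \<Longrightarrow> - a \<in> I"
    and is_ideal_diff: "a \<in> I \<Longrightarrow> b \<in> I \<Longrightarrow> a - b \<in> I"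
proof -
  show *: "0 \<in> I" "\<And>a b. a \<in> I \<Longrightarrow> b \<in> I \<Longrightarrow> a + b \<in> I" "\<And>a r. a \<in> I \<Longrightarrow> r * a \<in> I"
    using assms by (auto simp: is_ideal_def)
  show "a \<in> I \<Longrightarrow> a * r \<in> I" for a r
    using *(3)[of a r] by (simp add: mult.commute)
  show **: "a \<in> I \<Longrightarrow> - a \<in> I" for a
    using *(3)[of a "- 1"] by simp
  show "a \<in> I \<Longrightarrow> b \<in> I \<Longrightarrow> a - b \<in> I" for a b
    using *(2)[of a "- b"] ** by simp
qed

lemma is_ideal_sum:
  assumes "is_ideal I" "\<And>x. x \<in> A \<Longrightarrow> f x \<in> I"
  shows "sum f A \<in> I"
  using assms(2)
  by (induction A rule: infinite_finite_induct) (auto intro: is_idealD[OF assms(1)])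

lemma is_ideal_ideal_gen: "is_ideal (ideal_gen S)"
  unfolding is_ideal_def ideal_gen_def by blast

lemma ideal_gen_superset: "S \<subseteq> ideal_gen S"
  unfolding ideal_gen_def by blast

lemma ideal_gen_least: "is_ideal I \<Longrightarrow> S \<subseteq> I \<Longrightarrow> ideal_gen S \<subseteq> I"
  unfolding ideal_gen_def by blast

lemma ideal_gen_ideal: "is_ideal I \<Longrightarrow> ideal_gen I = I"
  using ideal_gen_least ideal_gen_superset by blast

text \<open>For an ideal \<open>I\<close> this is \<open>I + (f)\<close>. Membership comes with a
  single coefficient \<open>r\<close>, so arguments about regularity become ring identities modulo
  \<open>I\<close>.\<close>

definition adjoin :: "'a::comm_ring_1 set \<Rightarrow> 'a \<Rightarrow> 'a set" where
  "adjoin I f = {g. \<exists>r. g - r * f \<in> I}"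

lemma adjoinI: "g - r * f \<in> I \<Longrightarrow> g \<in> adjoin I f"
  by (auto simp: adjoin_def)

lemma adjoinE:
  assumes "g \<in> adjoin I f"
  obtains r where "g - r * f \<in> I"
  using assms by (auto simp: adjoin_def)

lemma is_ideal_adjoin:
  assumes "is_ideal I"
  shows "is_ideal (adjoin I f)"
  unfolding is_ideal_def
proof (intro conjI ballI allI)
  show "0 \<in> adjoin I f"
    using assms by (intro adjoinI[of _ 0]) (simp add: is_ideal_zero)
next
  fix a b assume "a \<in> adjoin I f" "b \<in> adjoin I f"
  then obtain r s where "a - r * f \<in> I" "b - s * f \<in> I"
    by (auto elim!: adjoinE)
  then have "(a - r * f) + (b - s * f) \<in> I"
    by (rule is_ideal_add[OF assms])
  then show "a + b \<in> adjoin I f"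
    by (intro adjoinI[of _ "r + s"]) (simp add: algebra_simps)
next
  fix r a assume "a \<in> adjoin I f"
  then obtain s where "a - s * f \<in> I"
    by (auto elim!: adjoinE)
  then have "r * (a - s * f) \<in> I"
    by (rule is_ideal_mult[OF assms])
  then show "r * a \<in> adjoin I f"
    by (intro adjoinI[of _ "r * s"]) (simp add: algebra_simps)
qed

lemma adjoin_superset: "I \<subseteq> adjoin I f"
  using adjoinI[of _ 0 f I] by auto

lemma ideal_gen_insert: "ideal_gen (insert f S) = adjoin (ideal_gen S) f"
proof
  have "f \<in> adjoin (ideal_gen S) f"
    by (intro adjoinI[of _ 1]) (simp add: is_ideal_zero is_ideal_ideal_gen)
  then show "ideal_gen (insert f S) \<subseteq> adjoin (ideal_gen S) f"
    using adjoin_superset[of "ideal_gen S" f] ideal_gen_superset[of S]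
    by (intro ideal_gen_least is_ideal_adjoin is_ideal_ideal_gen) auto
  show "adjoin (ideal_gen S) f \<subseteq> ideal_gen (insert f S)"
  proof
    fix g assume "g \<in> adjoin (ideal_gen S) f"
    then obtain r where r: "g - r * f \<in> ideal_gen S"
      by (rule adjoinE)
    have "ideal_gen S \<subseteq> ideal_gen (insert f S)"
      using ideal_gen_superset[of "insert f S"]
      by (intro ideal_gen_least is_ideal_ideal_gen) auto
    moreover have "r * f \<in> ideal_gen (insert f S)"
      using ideal_gen_superset[of "insert f S"]
      by (intro is_ideal_mult is_ideal_ideal_gen) auto
    ultimately have "(g - r * f) + r * f \<in> ideal_gen (insert f S)"
      using r by (intro is_ideal_add is_ideal_ideal_gen) auto
    then show "g \<in> ideal_gen (insert f S)"
      by simp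
  qed
qed

definition regular_on :: "'a::comm_ring_1 set \<Rightarrow> 'a \<Rightarrow> bool" where
  "regular_on I f \<longleftrightarrow> (\<forall>g. f * g \<in> I \<longrightarrow> g \<in> I)"

lemma regular_onD: "regular_on I f \<Longrightarrow> f * g \<in> I \<Longrightarrow> g \<in> I"
  by (simp add: regular_on_def)

lemma regular_on_cong_mod:
  assumes I: "is_ideal I" and "regular_on I f" "f - f' \<in> I"
  shows "regular_on I f'"
  unfolding regular_on_def
proof (intro allI impI)
  fix g assume "f' * g \<in> I"
  moreover have "g * (f - f') \<in> I"
    using assms(3) by (rule is_ideal_mult[OF I])
  ultimately have "f' * g + g * (f - f') \<in> I"
    by (rule is_ideal_add[OF I])
  then have "f * g \<in> I"
    by (simp add: algebra_simps)
  then show "g \<in> I"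
    by (rule regular_onD[OF assms(2)])
qed

lemma regular_on_Int:
  assumes "regular_on I f" "regular_on J f"
  shows "regular_on (I \<inter> J) f"
  using assms by (auto simp: regular_on_def)

text \<open>The half of the permutability of regular sequences that holds over every commutative
  ring: a relation \<open>f2 * g = r * f1\<close> modulo \<open>I\<close> forces
  \<open>r = s * f2\<close> modulo \<open>I\<close>, and then \<open>f2\<close> cancels from
  \<open>f2 * (g - s * f1)\<close>.\<close>

lemma regular_on_adjoin_swap:
  assumes I: "is_ideal I" and f2: "regular_on I f2" and f1: "regular_on (adjoin I f2) f1"
  shows "regular_on (adjoin I f1) f2"
  unfolding regular_on_def
proof (intro allI impI)
  fix g assume "f2 * g \<in> adjoin I f1"
  then obtain r where r: "f2 * g - r * f1 \<in> I"
    by (rule adjoinE)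
  have "- (f2 * g - r * f1) \<in> I"
    using r by (rule is_ideal_uminus[OF I])
  then have "f1 * r \<in> adjoin I f2"
    by (intro adjoinI[of _ g]) (simp add: algebra_simps)
  then have "r \<in> adjoin I f2"
    by (rule regular_onD[OF f1])
  then obtain s where s: "r - s * f2 \<in> I"
    by (rule adjoinE)
  have "(f2 * g - r * f1) + f1 * (r - s * f2) \<in> I"
    using r s by (blast intro: is_idealD[OF I])
  then have "f2 * (g - s * f1) \<in> I"
    by (simp add: algebra_simps)
  then have "g - s * f1 \<in> I"
    by (rule regular_onD[OF f2])
  then show "g \<in> adjoin I f1"
    by (rule adjoinI)
qed

text \<open>The depth lemma for \<open>0 \<rightarrow> R/(I \<inter> J) \<rightarrow> R/I \<oplus> R/J \<rightarrow> R/(I + J) \<rightarrow> 0\<close>, for sequences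
  of length two.\<close>
lemma regular_on_adjoin_Int:
  assumes I: "is_ideal I" and J: "is_ideal J"
    and f2: "regular_on (adjoin I f1) f2" "regular_on (adjoin J f1) f2"
    and f1: "\<And>g. f1 * g \<in> {a + b |a b. a \<in> I \<and> b \<in> J} \<Longrightarrow> g \<in> {a + b |a b. a \<in> I \<and> b \<in> J}"
  shows "regular_on (adjoin (I \<inter> J) f1) f2"
  unfolding regular_on_def
proof (intro allI impI)
  fix g assume "f2 * g \<in> adjoin (I \<inter> J) f1"
  then have "f2 * g \<in> adjoin I f1" "f2 * g \<in> adjoin J f1"
    by (auto simp: adjoin_def)
  then have "g \<in> adjoin I f1" "g \<in> adjoin J f1"
    using f2 regular_onD by blast+
  then obtain r s where r: "g - r * f1 \<in> I" and s: "g - s * f1 \<in> J"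
    by (auto elim!: adjoinE)
  have "f1 * (r - s) = - (g - r * f1) + (g - s * f1)"
    by (simp add: algebra_simps)
  then have "f1 * (r - s) \<in> {a + b |a b. a \<in> I \<and> b \<in> J}"
    using is_ideal_uminus[OF I r] s by blast
  from f1[OF this] obtain a b where ab: "r - s = a + b" "a \<in> I" "b \<in> J"
    by blast
  \<comment> \<open>The coefficients \<open>r\<close> and \<open>s\<close> differ by an element of
    \<open>I + J\<close>, so \<open>r - a = s + b\<close> serves both ideals at once.\<close>
  have "(g - r * f1) + f1 * a \<in> I" "(g - s * f1) - f1 * b \<in> J"
    using r s ab by (blast intro: is_idealD[OF I] is_idealD[OF J])+
  moreover have "(g - s * f1) - f1 * b = g - (r - a) * f1"
  proof -
    have "r = a + b + s"
      using ab(1) by (simp add: algebra_simps)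
    then show ?thesis
      by (simp add: algebra_simps)
  qed
  moreover have "(g - r * f1) + f1 * a = g - (r - a) * f1"
    by (simp add: algebra_simps)
  ultimately have "g - (r - a) * f1 \<in> I \<inter> J"
    by simp
  then show "g \<in> adjoin (I \<inter> J) f1"
    by (rule adjoinI)
qed

text \<open>In Cech terms, \<open>b / (u v)\<close> represents a socle class of \<open>H\<^sup>2\<close> of \<open>R/I\<close> with support in the ideal
  generated by \<open>u\<close>, \<open>v\<close> and the annihilator of \<open>b\<close>; following it through the connecting maps of
  \<open>f1\<close> and \<open>f2\<close> gives the element \<open>b * (f1u * f2v - f1v * f2u)\<close>, which lies in the
  socle modulo \<open>f1, f2\<close>, so \<open>f3\<close> kills it.\<close>
lemma regular_triple_imp_mem:
  fixes b :: "'a::comm_ring_1"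
  assumes I: "is_ideal I"
    and f1: "regular_on I f1" and f2: "regular_on (adjoin I f1) f2"
    and f3: "regular_on (adjoin (adjoin I f1) f2) f3"
    and e1: "f1 = f1u * u + f1v * v + p1" and p1: "p1 * b \<in> I"
    and e2: "f2 = f2u * u + f2v * v + p2" and p2: "p2 * b \<in> I"
    and e3: "f3 = f3u * u + f3v * v + p3" and p3: "p3 * b \<in> I"
  shows "b \<in> adjoin (adjoin I u) v"
proof -
  define h where "h = b * (f1u * f2v - f1v * f2u)"
  define iu where "iu = f1v * (p2 * b) - f2v * (p1 * b)"
  define iv where "iv = f2u * (p1 * b) - f1u * (p2 * b)"
  have iu: "iu \<in> I" and iv: "iv \<in> I"
    unfolding iu_def iv_def using p1 p2 by (blast intro: is_idealD[OF I])+
  have uh: "u * h = b * f2v * f1 - b * f1v * f2 + iu"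
    unfolding h_def e1 e2 iu_def by (simp add: algebra_simps)
  have vh: "v * h = b * f1u * f2 - b * f2u * f1 + iv"
    unfolding h_def e1 e2 iv_def by (simp add: algebra_simps)
  have mem: "f3u * iu + f3v * iv + (f1u * f2v - f1v * f2u) * (p3 * b) \<in> I"
    using iu iv p3 by (blast intro: is_idealD[OF I])
  have "f3 * h = f3u * (u * h) + f3v * (v * h) + (f1u * f2v - f1v * f2u) * (p3 * b)"
    unfolding e3 h_def by (simp add: algebra_simps)
  then have "f3 * h - (f3v * b * f1u - f3u * b * f1v) * f2 - (f3u * b * f2v - f3v * b * f2u) * f1
      = f3u * iu + f3v * iv + (f1u * f2v - f1v * f2u) * (p3 * b)"
    unfolding uh vh by (simp add: algebra_simps)
  with mem have "f3 * h - (f3v * b * f1u - f3u * b * f1v) * f2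
      - (f3u * b * f2v - f3v * b * f2u) * f1 \<in> I"
    by (simp only:)
  then have "f3 * h \<in> adjoin (adjoin I f1) f2"
    by (intro adjoinI)
  then have "h \<in> adjoin (adjoin I f1) f2"
    by (rule regular_onD[OF f3])
  then obtain r1 r2 where r: "h - r2 * f2 - r1 * f1 \<in> I"
    by (auto elim!: adjoinE)
  \<comment> \<open>Descent: multiply \<open>h = r2 * f2 + r1 * f1\<close> by \<open>u\<close>,
    compare with \<open>uh\<close> and cancel \<open>f2\<close> modulo \<open>f1\<close>. The same
    is done with \<open>v\<close> below.\<close>
  have "iu - u * (h - r2 * f2 - r1 * f1) \<in> I"
    using r iu by (blast intro: is_idealD[OF I])
  also have "iu - u * (h - r2 * f2 - r1 * f1) = iu - u * h + u * r2 * f2 + u * r1 * f1"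
    by (simp add: algebra_simps)
  also have "\<dots> = f2 * (b * f1v + u * r2) - (b * f2v - u * r1) * f1"
    unfolding uh by (simp add: algebra_simps)
  finally have "b * f1v + u * r2 \<in> adjoin I f1"
    by (rule regular_onD[OF f2, OF adjoinI])
  then obtain s where s: "b * f1v + u * r2 - s * f1 \<in> I"
    by (rule adjoinE)
  have "v * (h - r2 * f2 - r1 * f1) - iv \<in> I"
    using r iv by (blast intro: is_idealD[OF I])
  also have "v * (h - r2 * f2 - r1 * f1) - iv = v * h - iv - v * r2 * f2 - v * r1 * f1"
    by (simp add: algebra_simps)
  also have "\<dots> = f2 * (b * f1u - v * r2) - (b * f2u + v * r1) * f1"
    unfolding vh by (simp add: algebra_simps)
  finally have "b * f1u - v * r2 \<in> adjoin I f1"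
    by (rule regular_onD[OF f2, OF adjoinI])
  then obtain s' where s': "b * f1u - v * r2 - s' * f1 \<in> I"
    by (rule adjoinE)
  \<comment> \<open>The multipliers \<open>v\<close> and \<open>u\<close> eliminate
    \<open>r2\<close>; by \<open>e1\<close> the rest is a multiple of \<open>f1\<close>, which
    cancels modulo \<open>I\<close>.\<close>
  have "v * (b * f1v + u * r2 - s * f1) + u * (b * f1u - v * r2 - s' * f1) + p1 * b \<in> I"
    using s s' p1 by (blast intro: is_idealD[OF I])
  also have "v * (b * f1v + u * r2 - s * f1) + u * (b * f1u - v * r2 - s' * f1) + p1 * b
      = b * (f1u * u + f1v * v + p1) - f1 * (s * v + s' * u)"
    by (simp add: algebra_simps)
  also have "\<dots> = f1 * (b - s * v - s' * u)"
    unfolding e1[symmetric] by (simp add: algebra_simps)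
  finally have "b - s * v - s' * u \<in> I"
    by (rule regular_onD[OF f1])
  then show ?thesis
    by (intro adjoinI)
qed

lemma regular_seq_nthD:
  assumes I: "is_ideal I" and fs: "regular_seq I fs"
  shows "length fs \<ge> 1 \<Longrightarrow> regular_on I (fs ! 0)"
    and "length fs \<ge> 2 \<Longrightarrow> regular_on (adjoin I (fs ! 0)) (fs ! 1)"
    and "length fs \<ge> 3 \<Longrightarrow> regular_on (adjoin (adjoin I (fs ! 0)) (fs ! 1)) (fs ! 2)"
    and "k < length fs \<Longrightarrow> fs ! k \<in> max_hom"
proof -
  have reg: "i < length fs \<Longrightarrow> regular_on (ideal_gen (I \<union> set (take i fs))) (fs ! i)" for i
    using fs unfolding regular_seq_def regular_on_def by blast
  show "length fs \<ge> 1 \<Longrightarrow> regular_on I (fs ! 0)"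
    using reg[of 0] by (cases fs) (simp_all add: ideal_gen_ideal I)
  show "regular_on (adjoin I (fs ! 0)) (fs ! 1)" if "length fs \<ge> 2"
  proof -
    have "set (take 1 fs) = {fs ! 0}"
      using that by (cases fs) auto
    then have "ideal_gen (I \<union> set (take 1 fs)) = adjoin I (fs ! 0)"
      by (simp add: ideal_gen_insert ideal_gen_ideal I)
    with reg[of 1] that show ?thesis
      by simp
  qed
  show "regular_on (adjoin (adjoin I (fs ! 0)) (fs ! 1)) (fs ! 2)" if "length fs \<ge> 3"
  proof -
    have "take 2 fs = [fs ! 0, fs ! 1]"
      using that by (intro nth_equalityI) (auto simp: less_2_cases_iff)
    then have "I \<union> set (take 2 fs) = insert (fs ! 1) (insert (fs ! 0) I)"
      by auto
    then have "ideal_gen (I \<union> set (take 2 fs)) = adjoin (adjoin I (fs ! 0)) (fs ! 1)"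
      by (simp add: ideal_gen_insert ideal_gen_ideal I)
    with reg[of 2] that show ?thesis
      by simp
  qed
  show "k < length fs \<Longrightarrow> fs ! k \<in> max_hom"
    using fs nth_mem[of k fs] unfolding regular_seq_def by blast
qed

lemma depth_quot_eqI:
  assumes "regular_seq I fs" "length fs = n" "\<And>gs. regular_seq I gs \<Longrightarrow> length gs \<le> n"
  shows "depth_quot I = enat n"
  unfolding depth_quot_def
proof (rule antisym)
  show "(SUP fs \<in> {fs. regular_seq I fs}. enat (length fs)) \<le> enat n"
    using assms(3) by (intro SUP_least) auto
  show "enat n \<le> (SUP fs \<in> {fs. regular_seq I fs}. enat (length fs))"
    using assms(1,2) by (intro SUP_upper2[of fs]) auto
qed

section \<open>Symbolic powers of intersections of primary monomial ideals\<close>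

abbreviation (input) "lookup \<equiv> Poly_Mapping.lookup"
abbreviation (input) "keys \<equiv> Poly_Mapping.keys"

section \<open>Monomial ideals as spans of exponent sets\<close>

definition restr :: "(5 \<Rightarrow>\<^sub>0 nat) set \<Rightarrow> 'k::field poly5 \<Rightarrow> 'k poly5" where
  "restr U f = (\<Sum>a\<in>keys f \<inter> U. Poly_Mapping.single a (lookup f a))"

lemma lookup_restr: "lookup (restr U f) a = (if a \<in> U then lookup f a else 0)"
proof -
  have "lookup (restr U f) a = (\<Sum>b\<in>keys f \<inter> U. if b = a then lookup f b else 0)"
    by (auto simp: restr_def lookup_sum lookup_single when_def intro!: sum.cong)
  also have "\<dots> = (if a \<in> keys f \<inter> U then lookup f a else 0)"
    by (subst sum.delta) auto
  finally show ?thesis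
    by (auto simp: in_keys_iff)
qed

lemma keys_restr: "keys (restr U f) = keys f \<inter> U"
  by (auto simp: in_keys_iff lookup_restr split: if_splits)

lemma restr_UNIV: "restr UNIV f = f"
  by (rule poly_mapping_eqI) (simp add: lookup_restr)

lemma restr_add_Compl: "restr U f + restr (- U) f = f"
  by (rule poly_mapping_eqI) (simp add: lookup_restr lookup_add)

definition mono_span :: "(5 \<Rightarrow>\<^sub>0 nat) set \<Rightarrow> 'k::field poly5 set" where
  "mono_span U = {f. keys f \<subseteq> U}"

text \<open>Combines upward closure with independence of the coordinates outside \<open>F\<close>:
  the monomial ideal with exponent set \<open>U\<close> is extended from the polynomial ring in the
  variables of \<open>F\<close>.\<close>

definition up_closed_on :: "5 set \<Rightarrow> (5 \<Rightarrow>\<^sub>0 nat) set \<Rightarrow> bool" where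
  "up_closed_on F U \<longleftrightarrow> (\<forall>a b. a \<in> U \<longrightarrow> (\<forall>i\<in>F. lookup a i \<le> lookup b i) \<longrightarrow> b \<in> U)"

lemma up_closed_onD:
  "up_closed_on F U \<Longrightarrow> a \<in> U \<Longrightarrow> (\<And>i. i \<in> F \<Longrightarrow> lookup a i \<le> lookup b i) \<Longrightarrow> b \<in> U"
  unfolding up_closed_on_def by blast

lemma up_closed_on_add: "up_closed_on F U \<Longrightarrow> a \<in> U \<Longrightarrow> a + b \<in> U"
  by (erule up_closed_onD) (auto simp: lookup_add)

lemma up_closed_on_subset: "up_closed_on F U \<Longrightarrow> F \<subseteq> G \<Longrightarrow> up_closed_on G U"
  unfolding up_closed_on_def by blast

lemma up_closed_on_Int: "up_closed_on F U \<Longrightarrow> up_closed_on G V \<Longrightarrow> up_closed_on (F \<union> G) (U \<inter> V)"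
  unfolding up_closed_on_def by blast

lemma up_closed_on_Un: "up_closed_on F U \<Longrightarrow> up_closed_on G V \<Longrightarrow> up_closed_on (F \<union> G) (U \<union> V)"
  unfolding up_closed_on_def by blast

lemma is_ideal_mono_span:
  assumes "up_closed_on F U"
  shows "is_ideal (mono_span U :: 'k::field poly5 set)"
  unfolding is_ideal_def
proof (intro conjI ballI allI)
  show "(0 :: 'k poly5) \<in> mono_span U"
    by (simp add: mono_span_def)
next
  fix f g :: "'k poly5" assume "f \<in> mono_span U" "g \<in> mono_span U"
  then show "f + g \<in> mono_span U"
    using keys_add[of f g] by (auto simp: mono_span_def)
next
  fix f g :: "'k poly5" assume g: "g \<in> mono_span U"
  have "a + b \<in> U" if "b \<in> keys g" for a b
    using g that up_closed_on_add[OF assms, of b a] by (auto simp: mono_span_def add.commute)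
  then show "f * g \<in> mono_span U"
    using keys_mult[of f g] by (auto simp: mono_span_def)
qed

lemma mono_span_Int: "mono_span (U \<inter> V) = mono_span U \<inter> mono_span V"
  by (auto simp: mono_span_def)

lemma mono_span_mono: "U \<subseteq> V \<Longrightarrow> mono_span U \<subseteq> mono_span V"
  by (auto simp: mono_span_def)

lemma monom5_in_mono_span: "monom5 a \<in> mono_span U \<longleftrightarrow> a \<in> U"
  by (auto simp: mono_span_def monom5_def)

lemma monom5_mult: "monom5 a * monom5 b = monom5 (a + b)"
  by (simp add: monom5_def mult_single)

lemma var5_eq_monom5: "var5 i = monom5 (Poly_Mapping.single i 1)"
  by (simp add: var5_def monom5_def)

lemma is_ideal_monomsI:
  assumes "is_ideal I" "\<And>a. a \<in> keys f \<Longrightarrow> monom5 a \<in> I"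
  shows "f \<in> I"
proof -
  have "Poly_Mapping.single a (lookup f a) = Poly_Mapping.single 0 (lookup f a) * monom5 a" for a
    by (simp add: monom5_def mult_single)
  then have "Poly_Mapping.single a (lookup f a) \<in> I" if "a \<in> keys f" for a
    using is_ideal_mult[OF assms(1) assms(2)[OF that]] by simp
  then have "restr UNIV f \<in> I"
    unfolding restr_def by (intro is_ideal_sum assms) auto
  then show ?thesis
    by (simp add: restr_UNIV)
qed

lemma mono_span_eq_ideal_gen:
  assumes "up_closed_on F U"
  shows "mono_span U = (ideal_gen (monom5 ` U) :: 'k::field poly5 set)"
proof
  show "mono_span U \<subseteq> (ideal_gen (monom5 ` U) :: 'k poly5 set)"
  proof (rule subsetI, rule is_ideal_monomsI[OF is_ideal_ideal_gen])
     fix f :: "'k poly5" and a assume "f \<in> mono_span U" "a \<in> keys f"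
    then show "monom5 a \<in> (ideal_gen (monom5 ` U) :: 'k poly5 set)"
      using ideal_gen_superset[of "monom5 ` U"] by (auto simp: mono_span_def)
  qed
  show "(ideal_gen (monom5 ` U) :: 'k poly5 set) \<subseteq> mono_span U"
    by (intro ideal_gen_least is_ideal_mono_span[OF assms]) (auto simp: monom5_in_mono_span)
qed

lemma mono_span_UnE:
  assumes "f \<in> mono_span (U \<union> V)"
  obtains g h where "f = g + h" "g \<in> mono_span U" "h \<in> mono_span V"
proof
  show "f = restr U f + restr (- U) f"
    by (simp add: restr_add_Compl)
  show "restr U f \<in> mono_span U" "restr (- U) f \<in> mono_span V"
    using assms by (auto simp: mono_span_def keys_restr)
qed

lemma mono_span_Un:
  assumes "up_closed_on F U" "up_closed_on G V"
  shows "{g + h |g h. g \<in> mono_span U \<and> h \<in> mono_span V} = (mono_span (U \<union> V) :: 'k::field poly5 set)"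
proof
  have "is_ideal (mono_span (U \<union> V) :: 'k poly5 set)"
    by (rule is_ideal_mono_span[OF up_closed_on_Un[OF assms]])
  then show "{g + h |g h. g \<in> mono_span U \<and> h \<in> mono_span V} \<subseteq> (mono_span (U \<union> V) :: 'k poly5 set)"
    using mono_span_mono[of U "U \<union> V"] mono_span_mono[of V "U \<union> V"]
    by (auto intro!: is_ideal_add)
  show "(mono_span (U \<union> V) :: 'k poly5 set) \<subseteq> {g + h |g h. g \<in> mono_span U \<and> h \<in> mono_span V}"
    by (blast elim: mono_span_UnE)
qed

text \<open>\<open>mono_span U\<close> is primary to the ideal generated by the variables in \<open>F\<close>. For the proof, pick an
  exponent \<open>a0\<close> of \<open>f\<close> outside \<open>U\<close> of minimal \<open>F\<close>-degree: the part of \<open>s * f\<close> with the same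
  \<open>F\<close>-exponent is the product of the \<open>F\<close>-free part of \<open>s\<close> with the corresponding part of \<open>f\<close>,
  modulo terms in \<open>U\<close>.\<close>
lemma regular_on_mono_span:
  fixes s :: "'k::field poly5"
  assumes U: "up_closed_on F U"
    and c: "c \<in> keys s" "\<And>i. i \<in> F \<Longrightarrow> lookup c i = 0"
  shows "regular_on (mono_span U) s"
  unfolding regular_on_def
proof (intro allI impI, rule ccontr)
  fix f assume sf: "s * f \<in> mono_span U" and "f \<notin> mono_span U"
  define w where "w a = (\<Sum>i\<in>F. lookup a i)" for a :: "5 \<Rightarrow>\<^sub>0 nat"
  have "\<exists>a. a \<in> keys f - U"
    using \<open>f \<notin> mono_span U\<close> by (auto simp: mono_span_def)
  then obtain a0 where a0: "a0 \<in> keys f" "a0 \<notin> U"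
    and min: "\<And>a. a \<in> keys f - U \<Longrightarrow> w a0 \<le> w a"
    using arg_min_nat_lemma[of "\<lambda>a. a \<in> keys f - U" _ w] by blast
  define E where "E = {a. \<forall>i\<in>F. lookup a i = lookup a0 i}"
  define Z where "Z = {a::5 \<Rightarrow>\<^sub>0 nat. \<forall>i\<in>F. lookup a i = 0}"
  have "restr Z s \<noteq> 0" "restr E f \<noteq> 0"
    using c a0(1) lookup_restr[of Z s c] lookup_restr[of E f a0]
    by (auto simp: Z_def E_def in_keys_iff)
  \<comment> \<open>The polynomial ring is a domain.\<close>
  then have "restr Z s * restr E f \<noteq> 0"
    by simp
  then obtain k where k: "k \<in> keys (restr Z s * restr E f)"
    by (metis keys_eq_empty ex_in_conv)
  then have kE: "lookup k i = lookup a0 i" if "i \<in> F" for i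
    using keys_mult[of "restr Z s" "restr E f"] that
    by (fastforce simp: keys_restr Z_def E_def lookup_add)
  have kU: "k \<notin> U"
    using a0(2) up_closed_onD[OF U, of k a0] kE by force
  have wk: "w k = w a0"
    unfolding w_def using kE by (intro sum.cong) auto
  have "k \<notin> keys (restr Z s * restr (- E) f)"
  proof
    assume "k \<in> keys (restr Z s * restr (- E) f)"
    then obtain c a where "k = c + a" "c \<in> Z" "a \<notin> E"
      using keys_mult[of "restr Z s" "restr (- E) f"] by (auto simp: keys_restr)
    then show False
      using kE by (auto simp: Z_def E_def lookup_add)
  qed
  \<comment> \<open>Terms of \<open>s\<close> outside \<open>Z\<close> have positive
    \<open>F\<close>-degree, and exponents of \<open>f\<close> outside \<open>U\<close> have at
    least the \<open>F\<close>-degree of \<open>a0\<close>; a sum of the two outside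
    \<open>U\<close> has larger \<open>F\<close>-degree than \<open>k\<close>.\<close>
  moreover have "k \<notin> keys (restr (- Z) s * f)"
  proof
    assume "k \<in> keys (restr (- Z) s * f)"
    then obtain c a where ca: "k = c + a" "c \<notin> Z" "a \<in> keys f"
      using keys_mult[of "restr (- Z) s" f] by (auto simp: keys_restr)
    then obtain i where i: "i \<in> F" "lookup c i \<noteq> 0"
      by (auto simp: Z_def)
    have "w c \<noteq> 0"
      unfolding w_def using i by auto
    moreover have "w k = w c + w a"
      unfolding w_def ca(1) by (simp add: lookup_add sum.distrib)
    moreover have "a \<notin> U"
      using kU up_closed_on_add[OF U, of a c] ca(1) by (auto simp: add.commute)
    ultimately show False
      using min[of a] ca(3) wk by simp
  qed
  moreover have "s * f = restr Z s * restr E f + restr Z s * restr (- E) f + restr (- Z) s * f"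
  proof -
    have "s * f = restr Z s * (restr E f + restr (- E) f) + restr (- Z) s * f"
      unfolding restr_add_Compl by (simp add: restr_add_Compl flip: distrib_right)
    then show ?thesis
      by (simp add: distrib_left)
  qed
  ultimately have "lookup (s * f) k = lookup (restr Z s * restr E f) k"
    by (simp add: lookup_add in_keys_iff)
  then have "k \<in> keys (s * f)"
    using k by (simp add: in_keys_iff)
  then show False
    using sf kU by (auto simp: mono_span_def)
qed

text \<open>For upward closed \<open>U\<close>, the exponent set of the \<open>t\<close>-th power of
  the monomial ideal. The zeroth power is the unit ideal, hence \<open>UNIV\<close> and not
  \<open>{0}\<close>.\<close>

primrec set_pow :: "'a::comm_monoid_add set \<Rightarrow> nat \<Rightarrow> 'a set" where
  "set_pow U 0 = UNIV"
| "set_pow U (Suc t) = {a + b |a b. a \<in> U \<and> b \<in> set_pow U t}"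

lemma set_pow_mono: "U \<subseteq> V \<Longrightarrow> set_pow U t \<subseteq> set_pow V t"
  by (induction t) auto

lemma exists_restr_exponent:
  fixes b :: "5 \<Rightarrow>\<^sub>0 nat"
  shows "\<exists>c. \<forall>i. lookup c i = (if i \<in> F then lookup b i else 0)"
  by (rule exI[of _ "Abs_poly_mapping (\<lambda>i. if i \<in> F then lookup b i else 0)"]) simp

lemma up_closed_on_set_pow:
  assumes "up_closed_on F U"
  shows "up_closed_on F (set_pow U t)"
proof (induction t)
  case (Suc t)
  show ?case
    unfolding up_closed_on_def
  proof (intro allI impI)
    fix x c assume "x \<in> set_pow U (Suc t)" and le: "\<forall>i\<in>F. lookup x i \<le> lookup c i"
    then obtain a b where ab: "x = a + b" "a \<in> U" "b \<in> set_pow U t"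
      by auto
    \<comment> \<open>\<open>c2\<close> is \<open>b\<close> cut down to \<open>F\<close>; everything
      else in \<open>c\<close> goes into the summand \<open>c - c2\<close>, which dominates
      \<open>a\<close> on \<open>F\<close>.\<close>
    obtain c2 where c2: "\<And>i. lookup c2 i = (if i \<in> F then lookup b i else 0)"
      using exists_restr_exponent by metis
    have "c2 \<in> set_pow U t"
      using Suc ab(3) by (rule up_closed_onD) (simp add: c2)
    moreover have "c - c2 \<in> U"
      using assms ab(2) le by (rule_tac up_closed_onD) (auto simp: c2 lookup_minus ab(1) lookup_add)
    moreover have "c = (c - c2) + c2"
      using le by (intro poly_mapping_eqI) (auto simp: c2 lookup_minus lookup_add ab(1))
    ultimately show "c \<in> set_pow U (Suc t)"
      by auto
  qed
qed (simp add: up_closed_on_def)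

lemma ideal_pow_mono_span:
  assumes U: "up_closed_on F U"
  shows "ideal_pow (mono_span U) t = (mono_span (set_pow U t) :: 'k::field poly5 set)"
proof
  have "prod_list xs \<in> (mono_span (set_pow U (length xs)) :: 'k poly5 set)"
    if "set xs \<subseteq> mono_span U" for xs
    using that
  proof (induction xs)
    case (Cons x xs)
    then show ?case
      using keys_mult[of x "prod_list xs"] by (fastforce simp: mono_span_def)
  qed (simp add: mono_span_def)
  then show "ideal_pow (mono_span U) t \<subseteq> (mono_span (set_pow U t) :: 'k poly5 set)"
    unfolding ideal_pow_def
    by (intro ideal_gen_least is_ideal_mono_span[OF up_closed_on_set_pow[OF U]]) auto
  have ideal: "is_ideal (ideal_pow (mono_span U) t :: 'k poly5 set)"
    by (simp add: ideal_pow_def is_ideal_ideal_gen)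
  \<comment> \<open>The factor \<open>monom5 e\<close> absorbs the arbitrary exponent coming from
    \<open>set_pow U 0 = UNIV\<close>.\<close>
  have "\<exists>xs e. length xs = t \<and> set xs \<subseteq> (mono_span U :: 'k poly5 set)
          \<and> monom5 a = monom5 e * prod_list xs"
    if "a \<in> set_pow U t" for a
    using that
  proof (induction t arbitrary: a)
    case (Suc t)
    then obtain b c where bc: "a = b + c" "b \<in> U" "c \<in> set_pow U t"
      by auto
    with Suc.IH obtain xs :: "'k poly5 list" and e where
      "length xs = t" "set xs \<subseteq> mono_span U" "monom5 c = monom5 e * prod_list xs"
      by blast
    then have "length (monom5 b # xs) = Suc t \<and> set (monom5 b # xs) \<subseteq> mono_span U
        \<and> monom5 a = monom5 e * prod_list (monom5 b # xs)"
      using bc by (simp add: monom5_in_mono_span algebra_simps flip: monom5_mult)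
    then show ?case
      by blast
  qed auto
  then have "monom5 a \<in> (ideal_pow (mono_span U) t :: 'k poly5 set)" if "a \<in> set_pow U t" for a
    using that ideal_gen_superset[of "{prod_list xs |xs. length xs = t \<and> set xs \<subseteq> (mono_span U :: 'k poly5 set)}"]
      is_ideal_mult[OF ideal] unfolding ideal_pow_def by (fastforce)
  then show "mono_span (set_pow U t) \<subseteq> (ideal_pow (mono_span U) t :: 'k poly5 set)"
    using is_ideal_monomsI[OF ideal] by (auto simp: mono_span_def)
qed

section \<open>Primes generated by variables\<close>

definition face_prime :: "5 set \<Rightarrow> 'k::field poly5 set" where
  "face_prime F = mono_span {a. \<exists>i\<in>F. 0 < lookup a i}"

lemma up_closed_on_face: "up_closed_on F {a. \<exists>i\<in>F. 0 < lookup a i}"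
  unfolding up_closed_on_def by (auto intro: less_le_trans)

lemma not_in_face_primeE:
  assumes "s \<notin> face_prime F"
  obtains c where "c \<in> keys s" "\<And>i. i \<in> F \<Longrightarrow> lookup c i = 0"
proof -
  obtain c where "c \<in> keys s" "\<not> (\<exists>i\<in>F. 0 < lookup c i)"
    using assms unfolding face_prime_def mono_span_def by blast
  then show thesis
    using that[of c] by auto
qed

text \<open>An element outside has a term free of the variables in \<open>F\<close>, so
  \<open>regular_on_mono_span\<close> makes it a nonzerodivisor modulo the ideal.\<close>

lemma is_prime_ideal_face_prime: "is_prime_ideal (face_prime F :: 'k::field poly5 set)"
  unfolding is_prime_ideal_def
proof (intro conjI allI impI)
  show "is_ideal (face_prime F :: 'k poly5 set)"
    unfolding face_prime_def by (rule is_ideal_mono_span[OF up_closed_on_face])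
  have "1 \<notin> (face_prime F :: 'k poly5 set)"
    by (simp add: face_prime_def mono_span_def)
  then show "(face_prime F :: 'k poly5 set) \<noteq> UNIV"
    by blast
  fix a b :: "'k poly5" assume ab: "a * b \<in> face_prime F"
  show "a \<in> face_prime F \<or> b \<in> face_prime F"
  proof (cases "a \<in> face_prime F")
    case False
    then obtain c where "c \<in> keys a" "\<And>i. i \<in> F \<Longrightarrow> lookup c i = 0"
      by (rule not_in_face_primeE) blast
    then have "regular_on (face_prime F) a"
      unfolding face_prime_def by (rule regular_on_mono_span[OF up_closed_on_face])
    with ab show ?thesis
      using regular_onD by blast
  qed simp
qed

lemma var5_in_face_prime: "var5 i \<in> face_prime F \<longleftrightarrow> i \<in> F"
  by (auto simp: var5_eq_monom5 face_prime_def monom5_in_mono_span lookup_single when_def)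

lemma face_prime_subset_iff: "(face_prime F :: 'k::field poly5 set) \<subseteq> face_prime G \<longleftrightarrow> F \<subseteq> G"
proof
  assume "(face_prime F :: 'k poly5 set) \<subseteq> face_prime G"
  then show "F \<subseteq> G"
    by (metis subset_iff var5_in_face_prime)
next
  assume "F \<subseteq> G"
  then show "(face_prime F :: 'k poly5 set) \<subseteq> face_prime G"
    unfolding face_prime_def by (intro mono_span_mono) blast
qed

lemma face_prime_subset:
  fixes P :: "'k::field poly5 set"
  assumes "is_ideal P" "\<And>i. i \<in> F \<Longrightarrow> var5 i \<in> P"
  shows "face_prime F \<subseteq> P"
proof (rule subsetI, rule is_ideal_monomsI[OF assms(1)])
  fix f :: "'k poly5" and a assume "f \<in> face_prime F" "a \<in> keys f"
  then obtain i where i: "i \<in> F" "0 < lookup a i"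
    by (auto simp: face_prime_def mono_span_def)
  then have "a = Poly_Mapping.single i 1 + (a - Poly_Mapping.single i 1)"
    by (intro poly_mapping_eqI) (auto simp: lookup_add lookup_minus lookup_single when_def)
  then have "(monom5 a :: 'k poly5) = var5 i * monom5 (a - Poly_Mapping.single i 1)"
    unfolding var5_eq_monom5 monom5_mult by simp
  then show "monom5 a \<in> P"
    using is_ideal_mult_right[OF assms(1) assms(2)[OF i(1)]] by simp
qed

section \<open>Minimal primes and symbolic powers\<close>

lemma is_prime_ideal_multD: "is_prime_ideal P \<Longrightarrow> a * b \<in> P \<Longrightarrow> a \<in> P \<or> b \<in> P"
  by (simp add: is_prime_ideal_def)

lemma one_notin_prime_ideal:
  assumes "is_prime_ideal P"
  shows "1 \<notin> P"
proof
  assume "1 \<in> P"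
  then have "r * 1 \<in> P" for r
    using assms by (intro is_ideal_mult) (auto simp: is_prime_ideal_def)
  then show False
    using assms by (auto simp: is_prime_ideal_def)
qed

lemma monom5_sum_notin_prime:
  assumes P: "is_prime_ideal P" and "finite J" "\<And>j. j \<in> J \<Longrightarrow> monom5 (e j) \<notin> P"
  shows "monom5 (\<Sum>j\<in>J. e j) \<notin> P"
  using assms(2,3)
proof (induction J)
  case empty
  then show ?case
    using one_notin_prime_ideal[OF P] by (simp add: monom5_def)
next
  case (insert j J)
  then show ?case
    using is_prime_ideal_multD[OF P, of "monom5 (e j)" "monom5 (sum e J)"]
    by (auto simp: monom5_mult)
qed

lemma monom5_single_notin_prime:
  fixes P :: "'k::field poly5 set"
  assumes P: "is_prime_ideal P" and "var5 i \<notin> P"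
  shows "monom5 (Poly_Mapping.single i n) \<notin> P"
proof (induction n)
  case 0
  then show ?case
    using one_notin_prime_ideal[OF P] by (simp add: monom5_def)
next
  case (Suc n)
  have "(monom5 (Poly_Mapping.single i (Suc n)) :: 'k poly5) = var5 i * monom5 (Poly_Mapping.single i n)"
    by (simp add: var5_eq_monom5 monom5_mult flip: single_add)
  then show ?case
    using is_prime_ideal_multD[OF P, of "var5 i" "monom5 (Poly_Mapping.single i n)"] Suc assms(2)
    by auto
qed

lemma member_lookup_le_sum:
  fixes e :: "'j \<Rightarrow> 5 \<Rightarrow>\<^sub>0 nat"
  assumes "finite J" "j \<in> J"
  shows "lookup (e j) i \<le> lookup (\<Sum>j\<in>J. e j) i"
  using member_le_sum[of j J "\<lambda>j. lookup (e j) i"] assms by (simp add: lookup_sum)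

text \<open>If a prime \<open>P\<close> contains none of the face primes, each \<open>U j\<close>
  contains a power of some variable outside \<open>P\<close>; the product of these powers lies in
  the intersection but not in \<open>P\<close>. Hence every prime over the intersection contains a
  face prime, and these are incomparable by \<open>anti\<close>.\<close>

lemma min_primes_primary_Inter:
  assumes J: "finite J" and U: "\<And>j. j \<in> J \<Longrightarrow> up_closed_on (F j) (U j)"
    and prim: "\<And>j i. j \<in> J \<Longrightarrow> i \<in> F j \<Longrightarrow> \<exists>n. Poly_Mapping.single i n \<in> U j"
    and proper: "\<And>j. j \<in> J \<Longrightarrow> 0 \<notin> U j"
    and anti: "\<And>j j'. j \<in> J \<Longrightarrow> j' \<in> J \<Longrightarrow> F j \<subseteq> F j' \<Longrightarrow> j = j'"
  shows "min_primes (mono_span (\<Inter>j\<in>J. U j) :: 'k::field poly5 set) = (\<lambda>j. face_prime (F j)) ` J"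
proof -
  let ?K = "mono_span (\<Inter>j\<in>J. U j) :: 'k poly5 set"
  have sub: "?K \<subseteq> face_prime (F j)" if "j \<in> J" for j
  proof -
    have "\<exists>i\<in>F j. 0 < lookup a i" if "a \<in> U j" for a
    proof (rule ccontr)
      assume "\<not> (\<exists>i\<in>F j. 0 < lookup a i)"
      then have "0 \<in> U j"
        by (intro up_closed_onD[OF U[OF \<open>j \<in> J\<close>] \<open>a \<in> U j\<close>]) auto
      then show False
        using proper[OF \<open>j \<in> J\<close>] by simp
    qed
    then show ?thesis
      unfolding face_prime_def using that by (intro mono_span_mono) auto
  qed
  have ex: "\<exists>j\<in>J. face_prime (F j) \<subseteq> P" if P: "is_prime_ideal P" "?K \<subseteq> P" for P
  proof (rule ccontr)
    assume neg: "\<not> (\<exists>j\<in>J. face_prime (F j) \<subseteq> P)"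
    have "is_ideal P"
      using P(1) by (simp add: is_prime_ideal_def)
    then have "\<forall>j\<in>J. \<exists>i\<in>F j. var5 i \<notin> P"
      using neg face_prime_subset[of P] by blast
    then have "\<forall>j\<in>J. \<exists>e. e \<in> U j \<and> monom5 e \<notin> P"
      using prim monom5_single_notin_prime[OF P(1)] by metis
    then obtain e where e: "\<And>j. j \<in> J \<Longrightarrow> e j \<in> U j" "\<And>j. j \<in> J \<Longrightarrow> monom5 (e j) \<notin> P"
      by metis
    have "(\<Sum>j\<in>J. e j) \<in> U j" if "j \<in> J" for j
      using U[OF that] e(1)[OF that] by (rule up_closed_onD) (rule member_lookup_le_sum[OF J that])
    then have "monom5 (\<Sum>j\<in>J. e j) \<in> P"
      using P(2) by (auto simp: monom5_in_mono_span)
    then show False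
      using monom5_sum_notin_prime[OF P(1) J] e(2) by blast
  qed
  show ?thesis
  proof (intro equalityI subsetI)
    fix P assume "P \<in> min_primes ?K"
    then have P: "is_prime_ideal P" "?K \<subseteq> P"
      and min: "\<And>P'. is_prime_ideal P' \<Longrightarrow> ?K \<subseteq> P' \<Longrightarrow> P' \<subseteq> P \<Longrightarrow> P' = P"
      by (auto simp: min_primes_def)
    obtain j where "j \<in> J" "face_prime (F j) \<subseteq> P"
      using ex[OF P] by blast
    then show "P \<in> (\<lambda>j. face_prime (F j)) ` J"
      using min[OF is_prime_ideal_face_prime sub] by blast
  next
    fix P assume "P \<in> (\<lambda>j. face_prime (F j) :: 'k poly5 set) ` J"
    then obtain j where j: "j \<in> J" "P = face_prime (F j)"
      by blast
    have "P' = P" if P': "is_prime_ideal P'" "?K \<subseteq> P'" "P' \<subseteq> P" for P'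
    proof -
      obtain j' where j': "j' \<in> J" "face_prime (F j') \<subseteq> P'"
        using ex[OF P'(1,2)] by blast
      then have "F j' \<subseteq> F j"
        using P'(3) j(2) face_prime_subset_iff by blast
      then show ?thesis
        using anti j j' P'(3) by blast
    qed
    then show "P \<in> min_primes ?K"
      using j sub[OF j(1)] by (auto simp: min_primes_def is_prime_ideal_face_prime)
  qed
qed

text \<open>Supplies a monomial that becomes a unit at the prime of \<open>F j\<close> and lies in
  all other components. It is a product of powers of variables, one from \<open>F j' - F j\<close>
  for each other component.\<close>

lemma exists_exponent_off_face:
  assumes J: "finite J" and j: "j \<in> J" and U: "\<And>j. j \<in> J \<Longrightarrow> up_closed_on (F j) (U j)"
    and prim: "\<And>j i. j \<in> J \<Longrightarrow> i \<in> F j \<Longrightarrow> \<exists>n. Poly_Mapping.single i n \<in> U j"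
    and anti: "\<And>j j'. j \<in> J \<Longrightarrow> j' \<in> J \<Longrightarrow> F j \<subseteq> F j' \<Longrightarrow> j = j'"
  obtains e where "\<And>i. i \<in> F j \<Longrightarrow> lookup e i = 0" "\<And>j'. j' \<in> J \<Longrightarrow> j' \<noteq> j \<Longrightarrow> e \<in> U j'"
proof -
  have "\<exists>e. (\<forall>i\<in>F j. lookup e i = 0) \<and> e \<in> U j'" if j': "j' \<in> J" "j' \<noteq> j" for j'
  proof -
    obtain i where i: "i \<in> F j'" "i \<notin> F j"
      using anti[OF j'(1) j] j'(2) by blast
    obtain n where "Poly_Mapping.single i n \<in> U j'"
      using prim[OF j'(1) i(1)] by blast
    then show ?thesis
      using i(2) by (intro exI[of _ "Poly_Mapping.single i n"]) (auto simp: lookup_single when_def)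
  qed
  then obtain e where e: "\<And>j' i. j' \<in> J - {j} \<Longrightarrow> i \<in> F j \<Longrightarrow> lookup (e j') i = 0"
    "\<And>j'. j' \<in> J - {j} \<Longrightarrow> e j' \<in> U j'"
    by (metis DiffE singletonI)
  show ?thesis
  proof (rule that)
    show "lookup (\<Sum>j'\<in>J - {j}. e j') i = 0" if "i \<in> F j" for i
      using e(1) that by (simp add: lookup_sum)
    show "(\<Sum>j'\<in>J - {j}. e j') \<in> U j'" if j': "j' \<in> J" "j' \<noteq> j" for j'
      using U[OF j'(1)] e(2)
      by (rule up_closed_onD) (use J j' in \<open>auto intro!: member_lookup_le_sum\<close>)
  qed
qed

text \<open>Localizing the \<open>t\<close>-th power at the prime of \<open>F j\<close> leaves the
  \<open>t\<close>-th power of the component \<open>U j\<close>. That power is again primary, so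
  elements outside the prime cancel modulo it; conversely, \<open>t\<close> copies of the monomial
  from \<open>exists_exponent_off_face\<close> multiply it into the \<open>t\<close>-th power of the
  intersection.\<close>

theorem symbolic_power_primary_Inter:
  assumes J: "finite J" and U: "\<And>j. j \<in> J \<Longrightarrow> up_closed_on (F j) (U j)"
    and prim: "\<And>j i. j \<in> J \<Longrightarrow> i \<in> F j \<Longrightarrow> \<exists>n. Poly_Mapping.single i n \<in> U j"
    and proper: "\<And>j. j \<in> J \<Longrightarrow> 0 \<notin> U j"
    and anti: "\<And>j j'. j \<in> J \<Longrightarrow> j' \<in> J \<Longrightarrow> F j \<subseteq> F j' \<Longrightarrow> j = j'"
  shows "symbolic_power (mono_span (\<Inter>j\<in>J. U j) :: 'k::field poly5 set) t
    = mono_span (\<Inter>j\<in>J. set_pow (U j) t)"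
proof -
  let ?V = "\<Inter>j\<in>J. U j"
  have V: "up_closed_on UNIV ?V"
    unfolding up_closed_on_def
  proof (intro allI impI INT_I)
    fix a b j assume "a \<in> ?V" "\<forall>i\<in>UNIV. lookup a i \<le> lookup b i" "j \<in> J"
    then show "b \<in> U j"
      by (intro up_closed_onD[OF U, of j a b]) auto
  qed
  have contract: "loc_contract (mono_span (set_pow ?V t)) (face_prime (F j))
      = (mono_span (set_pow (U j) t) :: 'k poly5 set)" if j: "j \<in> J" for j
  proof (intro equalityI subsetI)
    fix f :: "'k poly5" assume "f \<in> loc_contract (mono_span (set_pow ?V t)) (face_prime (F j))"
    then obtain s where s: "s \<notin> face_prime (F j)" "s * f \<in> mono_span (set_pow ?V t)"
      by (auto simp: loc_contract_def)
    have "s * f \<in> mono_span (set_pow (U j) t)"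
      using s(2) mono_span_mono[OF set_pow_mono[of ?V "U j" t]] j by blast
    then show "f \<in> mono_span (set_pow (U j) t)"
      using regular_on_mono_span[OF up_closed_on_set_pow[OF U[OF j]]] s(1)
      by (metis not_in_face_primeE regular_onD)
  next
    fix f :: "'k poly5" assume f: "f \<in> mono_span (set_pow (U j) t)"
    obtain e where e: "\<And>i. i \<in> F j \<Longrightarrow> lookup e i = 0" "\<And>j'. j' \<in> J \<Longrightarrow> j' \<noteq> j \<Longrightarrow> e \<in> U j'"
      using exists_exponent_off_face[of J j F U] assms(1-3) anti j by blast
    have eV: "e + a \<in> ?V" if "a \<in> U j" for a
    proof
      fix j' assume j': "j' \<in> J"
      show "e + a \<in> U j'"
      proof (cases "j' = j")
        case True
        then show ?thesis
          using up_closed_on_add[OF U[OF j] that, of e] by (simp add: add.commute)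
      next
        case False
        then show ?thesis
          using up_closed_on_add[OF U[OF j'] e(2)[OF j']] by simp
      qed
    qed
    have "\<exists>c. (\<forall>i\<in>F j. lookup c i = 0) \<and> (\<forall>a\<in>set_pow (U j) t. c + a \<in> set_pow ?V t)"
    proof (induction t)
      case 0
      then show ?case
        by (auto intro: exI[of _ 0])
    next
      case (Suc t)
      then obtain c where c: "\<And>i. i \<in> F j \<Longrightarrow> lookup c i = 0"
        "\<And>a. a \<in> set_pow (U j) t \<Longrightarrow> c + a \<in> set_pow ?V t"
        by blast
      have "(e + c) + (a + b) \<in> set_pow ?V (Suc t)" if "a \<in> U j" "b \<in> set_pow (U j) t" for a b
      proof -
        have "(e + c) + (a + b) = (e + a) + (c + b)"
          by (simp add: ac_simps)
        then show ?thesis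
          using eV[OF that(1)] c(2)[OF that(2)] by (auto simp del: INT_iff)
      qed
      then show ?case
        using c(1) e(1) by (intro exI[of _ "e + c"]) (auto simp: lookup_add simp del: INT_iff)
    qed
    then obtain c where c: "\<And>i. i \<in> F j \<Longrightarrow> lookup c i = 0"
      "\<And>a. a \<in> set_pow (U j) t \<Longrightarrow> c + a \<in> set_pow ?V t"
      by blast
    have "monom5 c * f \<in> mono_span (set_pow ?V t)"
      using keys_mult[of "monom5 c" f] f c(2) by (fastforce simp: mono_span_def monom5_def)
    moreover have "monom5 c \<notin> face_prime (F j)"
      using c(1) by (auto simp: face_prime_def monom5_in_mono_span)
    ultimately show "f \<in> loc_contract (mono_span (set_pow ?V t)) (face_prime (F j))"
      by (auto simp: loc_contract_def)
  qed
  have "symbolic_power (mono_span ?V :: 'k poly5 set) t = (\<Inter>j\<in>J. mono_span (set_pow (U j) t))"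
    unfolding symbolic_power_def ideal_pow_mono_span[OF V]
      min_primes_primary_Inter[of J F U, OF J U prim proper anti, simplified]
    using contract by simp
  also have "\<dots> = mono_span (\<Inter>j\<in>J. set_pow (U j) t)"
    by (auto simp: mono_span_def)
  finally show ?thesis .
qed

section \<open>Depth of an intersection of three monomial ideals\<close>

lemma exhaust_5: "x = 0 \<or> x = 1 \<or> x = 2 \<or> x = 3 \<or> x = (4::5)"
proof (induct x)
  case (of_int z)
  then have "z = 0 \<or> z = 1 \<or> z = 2 \<or> z = 3 \<or> z = 4"
    by auto
  then show ?case
    by auto
qed

lemma UNIV_5: "UNIV = {0, 1, 2, 3, 4::5}"
  using exhaust_5 by auto

lemma sum_UNIV_5: "(\<Sum>i\<in>UNIV. f i) = f 0 + f 1 + f 2 + f 3 + f (4::5)" for f :: "5 \<Rightarrow> nat"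
  unfolding UNIV_5 by simp

lemma single_neq: "i \<noteq> j \<Longrightarrow> n \<noteq> 0 \<Longrightarrow> Poly_Mapping.single i n \<noteq> Poly_Mapping.single j m"
  by (auto simp: poly_mapping_eq_iff fun_eq_iff lookup_single when_def)

lemma exponent_neq_0_iff: "a \<noteq> 0 \<longleftrightarrow> (\<exists>i. 0 < lookup a i)" for a :: "5 \<Rightarrow>\<^sub>0 nat"
  by (auto simp: poly_mapping_eq_iff fun_eq_iff)

lemma adjoin_subset:
  assumes "is_ideal J" "I \<subseteq> J" "f \<in> J"
  shows "adjoin I f \<subseteq> J"
proof
  fix g assume "g \<in> adjoin I f"
  then obtain r where "g - r * f \<in> I"
    by (rule adjoinE)
  then have "(g - r * f) + r * f \<in> J"
    using assms by (intro is_ideal_add is_ideal_mult) auto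
  then show "g \<in> J"
    by simp
qed

lemma mem_adjoin: "is_ideal I \<Longrightarrow> f \<in> adjoin I f"
  by (rule adjoinI[of _ 1]) (simp add: is_ideal_zero)

lemma adjoin_cong:
  assumes I: "is_ideal I" and f: "f - f' \<in> I"
  shows "adjoin I f = adjoin I f'"
proof -
  have "f' \<in> adjoin I f" "f \<in> adjoin I f'"
    using f is_ideal_uminus[OF I f] by (auto intro!: adjoinI[of _ 1])
  then show ?thesis
    using I by (intro equalityI adjoin_subset is_ideal_adjoin adjoin_superset)
qed

lemma max_hom_eq: "(max_hom :: 'k::field poly5 set) = face_prime UNIV"
proof
  have "is_ideal (face_prime UNIV :: 'k poly5 set)"
    using is_prime_ideal_face_prime by (auto simp: is_prime_ideal_def)
  then show "(max_hom :: 'k poly5 set) \<subseteq> face_prime UNIV"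
    unfolding max_hom_def by (rule ideal_gen_least) (auto simp: var5_in_face_prime)
  show "(face_prime UNIV :: 'k poly5 set) \<subseteq> max_hom"
    unfolding max_hom_def using ideal_gen_superset[of "range var5"]
    by (intro face_prime_subset is_ideal_ideal_gen) auto
qed

lemma is_ideal_max_hom: "is_ideal max_hom"
  by (simp add: max_hom_def is_ideal_ideal_gen)

lemma max_hom_neq_UNIV: "(max_hom :: 'k::field poly5 set) \<noteq> UNIV"
  using is_prime_ideal_face_prime[of UNIV, where 'k = 'k] by (simp add: max_hom_eq is_prime_ideal_def)

lemma monom5_in_max_hom: "monom5 a \<in> (max_hom :: 'k::field poly5 set) \<longleftrightarrow> a \<noteq> 0"
  by (simp add: max_hom_eq face_prime_def monom5_in_mono_span exponent_neq_0_iff)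

lemma mono_span_subset_max_hom: "0 \<notin> U \<Longrightarrow> (mono_span U :: 'k::field poly5 set) \<subseteq> max_hom"
  unfolding max_hom_eq face_prime_def
  by (intro mono_span_mono) (auto simp flip: exponent_neq_0_iff)

lemma regular_seq_singleI:
  assumes "is_ideal I" "I \<subseteq> max_hom" "f \<in> max_hom" "regular_on I f"
  shows "regular_seq I [f]"
proof -
  have "ideal_gen (I \<union> set [f]) \<subseteq> max_hom"
    using assms by (intro ideal_gen_least is_ideal_max_hom) auto
  then show ?thesis
    using assms max_hom_neq_UNIV by (auto simp: regular_seq_def regular_on_def ideal_gen_ideal)
qed

lemma regular_seq_pairI:
  assumes "is_ideal I" "I \<subseteq> max_hom" "f \<in> max_hom" "g \<in> max_hom"
    and "regular_on I f" "regular_on (adjoin I f) g"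
  shows "regular_seq I [f, g]"
proof -
  have "ideal_gen (I \<union> set [f, g]) \<subseteq> max_hom"
    using assms by (intro ideal_gen_least is_ideal_max_hom) auto
  then show ?thesis
    using assms max_hom_neq_UNIV
    by (auto simp: regular_seq_def regular_on_def ideal_gen_ideal ideal_gen_insert less_Suc_eq)
qed

definition above :: "(5 \<Rightarrow>\<^sub>0 nat) \<Rightarrow> (5 \<Rightarrow>\<^sub>0 nat) set" where
  "above e = {a. \<forall>i. lookup e i \<le> lookup a i}"

lemma up_closed_on_above: "up_closed_on (keys e) (above e)"
  unfolding up_closed_on_def above_def
proof (intro allI impI CollectI)
  fix a b i assume "a \<in> {a. \<forall>i. lookup e i \<le> lookup a i}" "\<forall>i\<in>keys e. lookup a i \<le> lookup b i"
  then show "lookup e i \<le> lookup b i"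
    by (cases "i \<in> keys e") (auto simp: in_keys_iff intro: le_trans)
qed

lemma adjoin_monom5:
  assumes U: "up_closed_on F U"
  shows "adjoin (mono_span U) (monom5 e) = (mono_span (U \<union> above e) :: 'k::field poly5 set)"
proof
  have ideal: "is_ideal (adjoin (mono_span U) (monom5 e) :: 'k poly5 set)"
    by (rule is_ideal_adjoin[OF is_ideal_mono_span[OF U]])
  show "adjoin (mono_span U) (monom5 e) \<subseteq> (mono_span (U \<union> above e) :: 'k poly5 set)"
  proof (rule adjoin_subset)
    show "is_ideal (mono_span (U \<union> above e) :: 'k poly5 set)"
      by (rule is_ideal_mono_span[OF up_closed_on_Un[OF U up_closed_on_above]])
  qed (auto simp: monom5_in_mono_span above_def intro: mono_span_mono[THEN subsetD, rotated])
  show "(mono_span (U \<union> above e) :: 'k poly5 set) \<subseteq> adjoin (mono_span U) (monom5 e)"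
  proof (rule subsetI, rule is_ideal_monomsI[OF ideal])
    fix f :: "'k poly5" and a assume "f \<in> mono_span (U \<union> above e)" "a \<in> keys f"
    then consider "a \<in> U" | "a \<in> above e"
      by (auto simp: mono_span_def)
    then show "monom5 a \<in> (adjoin (mono_span U) (monom5 e) :: 'k poly5 set)"
    proof cases
      case 1
      then show ?thesis
        using adjoin_superset[of "mono_span U :: 'k poly5 set"] monom5_in_mono_span by blast
    next
      case 2
      then have "a = (a - e) + e"
        by (intro poly_mapping_eqI) (auto simp: above_def lookup_add lookup_minus)
      then have "(monom5 a :: 'k poly5) = monom5 (a - e) * monom5 e"
        by (simp add: monom5_mult)
      then show ?thesis
        by (simp add: is_ideal_mult[OF ideal mem_adjoin[OF is_ideal_mono_span[OF U]]])
    qed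
  qed
qed

section \<open>Upper bounds for the depth\<close>

lemma face_prime_singleton:
  assumes "f \<in> face_prime {i}"
  obtains r where "f = r * var5 i"
proof -
  have "is_ideal {0 :: 'a poly5}"
    by (auto simp: is_ideal_def)
  then have "face_prime {i} \<subseteq> adjoin {0} (var5 i :: 'a poly5)"
    by (intro face_prime_subset is_ideal_adjoin) (auto intro: mem_adjoin)
  then obtain r where "f - r * var5 i \<in> {0}"
    using assms by (blast elim: adjoinE)
  then show thesis
    using that[of r] by simp
qed

text \<open>Brings elements of the maximal ideal into the form used by
  \<open>regular_triple_imp_mem\<close>, where \<open>u\<close> and \<open>v\<close> are the two
  variables on which the third component does not depend.\<close>

lemma max_hom_split:
  fixes f :: "'k::field poly5"
  assumes "f \<in> max_hom"
  obtains r s p where "f = r * var5 3 + s * var5 4 + p" "p \<in> face_prime {0, 1, 2}"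
proof -
  have U: "UNIV = {3} \<union> ({4} \<union> {0, 1, 2::5})"
    using UNIV_5 by auto
  have "{a::5 \<Rightarrow>\<^sub>0 nat. \<exists>i\<in>UNIV. 0 < lookup a i}
    = {a. \<exists>i\<in>{3}. 0 < lookup a i} \<union> ({a. \<exists>i\<in>{4}. 0 < lookup a i} \<union> {a. \<exists>i\<in>{0, 1, 2}. 0 < lookup a i})"
    by (simp only: U bex_Un Collect_disj_eq)
  then have "f \<in> mono_span ({a. \<exists>i\<in>{3}. 0 < lookup a i}
      \<union> ({a. \<exists>i\<in>{4}. 0 < lookup a i} \<union> {a. \<exists>i\<in>{0, 1, 2}. 0 < lookup a i}))"
    using assms unfolding max_hom_eq face_prime_def by simp
  then obtain g g' where g: "f = g + g'" "g \<in> face_prime {3}"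
    and g': "g' \<in> mono_span ({a. \<exists>i\<in>{4}. 0 < lookup a i} \<union> {a. \<exists>i\<in>{0, 1, 2}. 0 < lookup a i})"
    unfolding face_prime_def by (rule mono_span_UnE)
  from g' obtain h p where h: "g' = h + p" "h \<in> face_prime {4}" and p: "p \<in> face_prime {0, 1, 2}"
    unfolding face_prime_def by (rule mono_span_UnE)
  obtain r s where "g = r * var5 3" "h = s * var5 4"
    using face_prime_singleton[OF g(2)] face_prime_singleton[OF h(2)] by metis
  then show thesis
    using that[OF _ p, of r s] g(1) h(1) by (simp add: add.assoc)
qed

text \<open>An exponent \<open>a\<close> in \<open>C\<close> but not in \<open>A \<union> B\<close>, chosen maximal, gives a socle class of \<open>H\<^sup>1\<close>: the
  section of the structure sheaf that is the monomial of \<open>a\<close> on the zero set of \<open>A\<close> and zero on that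
  of \<open>B\<close>. Its product with \<open>f \<in> max_hom\<close> is the element \<open>q\<close> of the splitting below.\<close>
lemma not_regular_pair_if_disconnected:
  fixes f1 f2 :: "'k::field poly5"
  assumes A: "up_closed_on FA A" and B: "up_closed_on FB B" and C: "up_closed_on FC C"
    and a: "a \<notin> A" "a \<notin> B" "a \<in> C"
    and bounded: "\<And>b. b \<notin> A \<Longrightarrow> b \<notin> B \<Longrightarrow> (\<Sum>i\<in>UNIV. lookup b i) < n"
    and e1: "\<And>i. i \<in> FA \<Longrightarrow> lookup e1 i = 0" "e1 \<in> B \<inter> C"
    and e2: "\<And>i. i \<in> FB \<Longrightarrow> lookup e2 i = 0" "e2 \<in> A \<inter> C"
    and f1: "f1 \<in> max_hom" "regular_on (mono_span (A \<inter> B \<inter> C)) f1"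
    and f2: "f2 \<in> max_hom" "regular_on (adjoin (mono_span (A \<inter> B \<inter> C)) f1) f2"
  shows False
proof -
  let ?I = "mono_span (A \<inter> B \<inter> C) :: 'k poly5 set"
  define w where "w b = (\<Sum>i\<in>UNIV. lookup b i)" for b :: "5 \<Rightarrow>\<^sub>0 nat"
  have "\<forall>b. b \<notin> A \<and> b \<notin> B \<and> b \<in> C \<longrightarrow> w b < n"
    using bounded by (auto simp: w_def)
  then obtain a0 where a0: "a0 \<notin> A" "a0 \<notin> B" "a0 \<in> C"
    and max: "\<And>b. b \<notin> A \<Longrightarrow> b \<notin> B \<Longrightarrow> b \<in> C \<Longrightarrow> w b \<le> w a0"
    using ex_has_greatest_nat[of "\<lambda>b. b \<notin> A \<and> b \<notin> B \<and> b \<in> C" a w n] a by blast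
  \<comment> \<open>By maximality of \<open>a0\<close>, every nonconstant monomial moves it into
    \<open>A\<close> or \<open>B\<close>.\<close>
  have shift: "a0 + k \<in> (A \<inter> C) \<union> (B \<inter> C)" if k: "\<exists>i. 0 < lookup k i" for k
  proof -
    obtain i where "0 < lookup k i"
      using k by blast
    then have "0 < w k"
      unfolding w_def by (intro sum_pos2[of _ i]) auto
    moreover have "w (a0 + k) = w a0 + w k"
      by (simp add: w_def lookup_add sum.distrib)
    moreover have "a0 + k \<in> C"
      using up_closed_on_add[OF C a0(3)] .
    ultimately show ?thesis
      using max[of "a0 + k"] by auto
  qed
  have split: "\<exists>p q. monom5 a0 * f = p + q \<and> p \<in> mono_span (A \<inter> C) \<and> q \<in> mono_span (B \<inter> C)"
    if "f \<in> max_hom" for f :: "'k poly5"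
  proof -
    have "keys (monom5 a0 * f) \<subseteq> (A \<inter> C) \<union> (B \<inter> C)"
      using keys_mult[of "monom5 a0" f] shift that
      by (fastforce simp: monom5_def max_hom_eq face_prime_def mono_span_def)
    then have "monom5 a0 * f \<in> mono_span ((A \<inter> C) \<union> (B \<inter> C))"
      by (simp add: mono_span_def)
    then obtain p q where "monom5 a0 * f = p + q" "p \<in> mono_span (A \<inter> C)" "q \<in> mono_span (B \<inter> C)"
      by (rule mono_span_UnE)
    then show ?thesis
      by blast
  qed
  obtain p1 q1 where pq1: "monom5 a0 * f1 = p1 + q1" "p1 \<in> mono_span (A \<inter> C)" "q1 \<in> mono_span (B \<inter> C)"
    using split[OF f1(1)] by blast
  obtain p2 q2 where pq2: "monom5 a0 * f2 = p2 + q2" "p2 \<in> mono_span (A \<inter> C)" "q2 \<in> mono_span (B \<inter> C)"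
    using split[OF f2(1)] by blast
  have IA: "is_ideal (mono_span A :: 'k poly5 set)" and IB: "is_ideal (mono_span B :: 'k poly5 set)"
    and IAC: "is_ideal (mono_span (A \<inter> C) :: 'k poly5 set)"
    and IBC: "is_ideal (mono_span (B \<inter> C) :: 'k poly5 set)"
    using A B up_closed_on_Int[OF A C] up_closed_on_Int[OF B C] by (auto intro: is_ideal_mono_span)
  \<comment> \<open>Comparing the two splittings of \<open>monom5 a0 * f1 * f2\<close> shows that
    this element of \<open>B \<inter> C\<close> also lies in \<open>A \<inter> C\<close>; hence
    \<open>f2\<close> kills \<open>q1\<close> modulo \<open>I\<close> and \<open>f1\<close>.\<close>
  have "f2 * q1 - q2 * f1 \<in> mono_span (B \<inter> C)"
    using pq1(3) pq2(3) by (blast intro: is_idealD[OF IBC])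
  moreover have "f1 * p2 - f2 * p1 \<in> mono_span (A \<inter> C)"
    using pq1(2) pq2(2) by (blast intro: is_idealD[OF IAC])
  moreover have "f1 * p2 - f2 * p1 = f2 * q1 - q2 * f1"
  proof -
    have "f1 * (p2 + q2) = f2 * (p1 + q1)"
      unfolding pq1(1)[symmetric] pq2(1)[symmetric] by (simp add: ac_simps)
    then show ?thesis
      by (simp add: algebra_simps)
  qed
  ultimately have "f2 * q1 - q2 * f1 \<in> ?I"
    by (auto simp: mono_span_def)
  then have "q1 \<in> adjoin ?I f1"
    using regular_onD[OF f2(2)] by (blast intro: adjoinI)
  then obtain g where g: "q1 - g * f1 \<in> ?I"
    by (rule adjoinE)
  \<comment> \<open>\<open>f1\<close> also cancels modulo a single component: multiply by a monomial
    \<open>e\<close> that leads from \<open>U\<close> into the intersection, cancel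
    \<open>f1\<close> there, then cancel \<open>e\<close> modulo \<open>U\<close>.\<close>
  have reg: "h \<in> mono_span U" if "f1 * h \<in> mono_span U" "up_closed_on F U" "e \<in> keys (monom5 e :: 'k poly5)"
    "\<And>i. i \<in> F \<Longrightarrow> lookup e i = 0" "\<And>b. b \<in> U \<Longrightarrow> e + b \<in> A \<inter> B \<inter> C" "A \<inter> B \<inter> C \<subseteq> U"
    for h U F and e :: "5 \<Rightarrow>\<^sub>0 nat"
  proof -
    have "f1 * (monom5 e * h) = monom5 e * (f1 * h)"
      by (simp add: ac_simps)
    moreover have "monom5 e * (f1 * h) \<in> ?I"
      using keys_mult[of "monom5 e" "f1 * h"] that(1,5)
      by (fastforce simp: mono_span_def monom5_def)
    ultimately have "f1 * (monom5 e * h) \<in> ?I"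
      by (simp only:)
    then have "monom5 e * h \<in> mono_span U"
      using regular_onD[OF f1(2)] mono_span_mono[OF that(6)] by blast
    moreover have "regular_on (mono_span U) (monom5 e :: 'k poly5)"
      using that(2,3,4) by (rule regular_on_mono_span)
    ultimately show ?thesis
      using regular_onD by blast
  qed
  have key: "e \<in> keys (monom5 e :: 'k poly5)" for e
    by (simp add: monom5_def)
  have "q1 \<in> mono_span B" "q1 - g * f1 \<in> mono_span B"
    using pq1(3) g by (auto simp: mono_span_def)
  then have "q1 - (q1 - g * f1) \<in> mono_span B"
    by (rule is_ideal_diff[OF IB])
  then have "f1 * g \<in> mono_span B"
    by (simp add: mult.commute)
  then have "g \<in> mono_span B"
  proof (rule reg[OF _ B key[of e2] e2(1)])
    show "e2 + b \<in> A \<inter> B \<inter> C" if "b \<in> B" for b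
      using e2(2) that up_closed_on_add[OF A, of e2 b] up_closed_on_add[OF B, of b e2]
        up_closed_on_add[OF C, of e2 b] by (auto simp: add.commute)
  qed auto
  moreover have "monom5 a0 - g \<in> mono_span A"
  proof -
    have "p1 \<in> mono_span A" "q1 - g * f1 \<in> mono_span A"
      using pq1(2) g by (auto simp: mono_span_def)
    then have "p1 + (q1 - g * f1) \<in> mono_span A"
      by (rule is_ideal_add[OF IA])
    also have "p1 + (q1 - g * f1) = f1 * (monom5 a0 - g)"
      using pq1(1) by (simp add: algebra_simps)
    finally show ?thesis
    proof (rule reg[OF _ A key[of e1] e1(1)])
      show "e1 + b \<in> A \<inter> B \<inter> C" if "b \<in> A" for b
        using e1(2) that up_closed_on_add[OF A, of b e1] up_closed_on_add[OF B, of e1 b]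
          up_closed_on_add[OF C, of e1 b] by (auto simp: add.commute)
    qed auto
  qed
  \<comment> \<open>\<open>g\<close> would be a global polynomial inducing the disconnected section:
    its coefficient at \<open>a0\<close> is 0 because \<open>a0 \<notin> B\<close>, and 1 because
    \<open>a0 \<notin> A\<close>.\<close>
  ultimately have "lookup g a0 = 0" "lookup (monom5 a0 - g) a0 = 0"
    using a0 by (auto simp: mono_span_def in_keys_iff)
  then show False
    by (simp add: monom5_def lookup_minus)
qed

text \<open>An explicit form of the bound of the depth by the dimension of an associated prime, here
  \<open>(x, y, z)\<close> of dimension two. A monomial of \<open>V - C\<close> in
  \<open>x, y, z\<close> of maximal degree is killed by \<open>x, y, z\<close> modulo
  \<open>V \<inter> C\<close>; a regular triple would put it into
  \<open>V \<inter> C + (u, v)\<close>.\<close>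

lemma not_regular_triple:
  fixes f1 f2 f3 :: "'k::field poly5"
  assumes V: "up_closed_on UNIV V" and C: "up_closed_on {0, 1, 2} C"
    and b: "b \<in> V" "b \<notin> C" "lookup b 3 = 0" "lookup b 4 = 0"
    and bounded: "\<And>b. b \<notin> C \<Longrightarrow> lookup b 0 + lookup b 1 + lookup b 2 < n"
    and f: "f1 \<in> max_hom" "f2 \<in> max_hom" "f3 \<in> max_hom"
    and reg: "regular_on (mono_span (V \<inter> C)) f1" "regular_on (adjoin (mono_span (V \<inter> C)) f1) f2"
      "regular_on (adjoin (adjoin (mono_span (V \<inter> C)) f1) f2) f3"
  shows False
proof -
  let ?I = "mono_span (V \<inter> C) :: 'k poly5 set"
  define w where "w b = lookup b 0 + lookup b 1 + lookup b 2" for b :: "5 \<Rightarrow>\<^sub>0 nat"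
  define good where "good b \<longleftrightarrow> b \<in> V \<and> b \<notin> C \<and> lookup b 3 = 0 \<and> lookup b 4 = 0" for b
  have "\<forall>b. good b \<longrightarrow> w b < n"
    using bounded by (auto simp: good_def w_def)
  then obtain b0 where b0: "good b0" and max: "\<And>b. good b \<Longrightarrow> w b \<le> w b0"
    using ex_has_greatest_nat[of good b w n] b by (auto simp: good_def)
  have step: "b0 + Poly_Mapping.single i 1 \<in> C" if i: "i \<in> {0, 1, 2}" for i
  proof (rule ccontr)
    assume "b0 + Poly_Mapping.single i 1 \<notin> C"
    then have "good (b0 + Poly_Mapping.single i 1)"
      using b0 i up_closed_on_add[OF V] by (auto simp: good_def lookup_add lookup_single when_def)
    moreover have "w (b0 + Poly_Mapping.single i 1) = Suc (w b0)"
      using i by (auto simp: w_def lookup_add lookup_single when_def)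
    ultimately show False
      using max by fastforce
  qed
  have shift: "k + b0 \<in> V \<inter> C" if k: "\<exists>i\<in>{0, 1, 2}. 0 < lookup k i" for k
  proof
    show "k + b0 \<in> V"
      using b0 up_closed_on_add[OF V, of b0 k] by (simp add: good_def add.commute)
    obtain i where "i \<in> {0, 1, 2}" "0 < lookup k i"
      using k by blast
    then show "k + b0 \<in> C"
      by (intro up_closed_onD[OF C step[of i]]) (auto simp: lookup_add lookup_single when_def)
  qed
  have kill: "p * monom5 b0 \<in> ?I" if "p \<in> face_prime {0, 1, 2}" for p
    using that keys_mult[of p "monom5 b0"] shift
    by (fastforce simp: face_prime_def mono_span_def monom5_def)
  have VC: "up_closed_on UNIV (V \<inter> C)"
    using up_closed_on_Int[OF V C] by simp
  obtain r1 s1 p1 where 1: "f1 = r1 * var5 3 + s1 * var5 4 + p1" "p1 \<in> face_prime {0, 1, 2}"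
    using max_hom_split[OF f(1)] .
  obtain r2 s2 p2 where 2: "f2 = r2 * var5 3 + s2 * var5 4 + p2" "p2 \<in> face_prime {0, 1, 2}"
    using max_hom_split[OF f(2)] .
  obtain r3 s3 p3 where 3: "f3 = r3 * var5 3 + s3 * var5 4 + p3" "p3 \<in> face_prime {0, 1, 2}"
    using max_hom_split[OF f(3)] .
  have "monom5 b0 \<in> adjoin (adjoin ?I (var5 3)) (var5 4)"
    by (rule regular_triple_imp_mem[OF is_ideal_mono_span[OF VC] reg 1(1) kill[OF 1(2)]
          2(1) kill[OF 2(2)] 3(1) kill[OF 3(2)]])
  also have "\<dots> = mono_span (V \<inter> C \<union> above (Poly_Mapping.single 3 1) \<union> above (Poly_Mapping.single 4 1))"
    unfolding var5_eq_monom5 adjoin_monom5[OF VC]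
      adjoin_monom5[OF up_closed_on_Un[OF VC up_closed_on_above]] ..
  finally show False
    using b0 by (auto simp: good_def monom5_in_mono_span above_def lookup_single when_def
        dest: spec[of _ 3] spec[of _ 4])
qed

section \<open>A regular pair in the connected case\<close>

lemma regular_on_sum_34:
  assumes "up_closed_on F U" "3 \<notin> F \<or> 4 \<notin> F"
  shows "regular_on (mono_span U) (var5 3 + var5 4 :: 'k::field poly5)"
proof -
  have "Poly_Mapping.single 3 (1::nat) \<noteq> Poly_Mapping.single (4::5) 1"
    by (rule single_neq) auto
  then have "Poly_Mapping.single 3 1 \<in> keys (var5 3 + var5 4 :: 'k poly5)"
    "Poly_Mapping.single 4 1 \<in> keys (var5 3 + var5 4 :: 'k poly5)"
    by (auto simp: var5_def in_keys_iff lookup_add lookup_single when_def)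
  then show ?thesis
    using assms(2) regular_on_mono_span[OF assms(1)] by (metis lookup_single_not_eq)
qed

lemma regular_on_adjoin_mono_span_Int:
  fixes f1 f2 :: "'k::field poly5"
  assumes U: "up_closed_on F U" and V: "up_closed_on G V"
    and "regular_on (adjoin (mono_span U) f1) f2" "regular_on (adjoin (mono_span V) f1) f2"
    and f1: "regular_on (mono_span (U \<union> V)) f1"
  shows "regular_on (adjoin (mono_span (U \<inter> V)) f1) f2"
  unfolding mono_span_Int
proof (rule regular_on_adjoin_Int[OF is_ideal_mono_span[OF U] is_ideal_mono_span[OF V] assms(3,4)])
  fix g assume "f1 * g \<in> {a + b |a b. a \<in> mono_span U \<and> b \<in> mono_span V}"
  then show "g \<in> {a + b |a b. a \<in> mono_span U \<and> b \<in> mono_span V}"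
    unfolding mono_span_Un[OF U V] by (rule regular_onD[OF f1])
qed

text \<open>The shape of \<open>f2\<close> makes it congruent to a single monomial modulo each of the three ideals, so that
  adjoining it leads to monomial ideals again.\<close>
lemma regular_pair_if_connected:
  fixes N :: nat
  defines "f1 \<equiv> var5 3 + var5 4 :: 'k::field poly5"
    and "f2 \<equiv> monom5 (Poly_Mapping.single 0 N) + monom5 (Poly_Mapping.single 1 N)
      + monom5 (Poly_Mapping.single 3 N + Poly_Mapping.single 4 N) :: 'k poly5"
  assumes A: "up_closed_on {1, 2, 3} A" and B: "up_closed_on {0, 2, 4} B"
    and C: "up_closed_on {0, 1, 2} C" and sub: "C \<subseteq> A \<union> B" and N: "N > 0"
    and inA: "Poly_Mapping.single 1 N \<in> A" "Poly_Mapping.single 3 N \<in> A"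
    and inB: "Poly_Mapping.single 0 N \<in> B" "Poly_Mapping.single 4 N \<in> B"
    and inC: "Poly_Mapping.single 0 N \<in> C" "Poly_Mapping.single 1 N \<in> C"
  shows "regular_on (adjoin (mono_span (A \<inter> B \<inter> C)) f1) f2"
proof -
  let ?x = "Poly_Mapping.single 0 N :: 5 \<Rightarrow>\<^sub>0 nat" and ?y = "Poly_Mapping.single 1 N :: 5 \<Rightarrow>\<^sub>0 nat"
  let ?u = "Poly_Mapping.single 3 N :: 5 \<Rightarrow>\<^sub>0 nat" and ?v = "Poly_Mapping.single 4 N :: 5 \<Rightarrow>\<^sub>0 nat"
  note ideal = is_ideal_mono_span[where 'k = 'k]
  \<comment> \<open>The two powers have disjoint supports, so their product is their least common
    multiple.\<close>
  have "lookup (?u + ?v) i \<le> n \<longleftrightarrow> lookup ?u i \<le> n \<and> lookup ?v i \<le> n" for i n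
    by (cases "i = 3") (auto simp: lookup_add lookup_single when_def)
  then have uv: "above (?u + ?v) = above ?u \<inter> above ?v"
    unfolding above_def by blast
  \<comment> \<open>Modulo \<open>U\<close> the element \<open>f2\<close> is the monomial of
    \<open>e\<close>, which is regular as it avoids \<open>F\<close>. Adjoining it first gives a
    monomial ideal, on which \<open>f1\<close> is tested; then the order is swapped.\<close>
  have main: "regular_on (adjoin (mono_span U) f1) f2"
    if U: "up_closed_on F U" and mem: "f2 - monom5 e \<in> mono_span U" and e: "keys e \<inter> F = {}"
      and reg: "regular_on (mono_span (U \<union> above e)) f1" for U F e
  proof (rule regular_on_adjoin_swap[OF ideal[OF U]])
    have "monom5 e - f2 \<in> mono_span U"
      using is_ideal_uminus[OF ideal[OF U] mem] by simp
    moreover have "regular_on (mono_span U) (monom5 e)"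
      using e by (intro regular_on_mono_span[OF U, of e]) (auto simp: monom5_def in_keys_iff)
    ultimately show "regular_on (mono_span U) f2"
      using regular_on_cong_mod[OF ideal[OF U]] by blast
    show "regular_on (adjoin (mono_span U) f2) f1"
      using reg by (simp add: adjoin_cong[OF ideal[OF U] mem] adjoin_monom5[OF U])
  qed
  have regA: "regular_on (adjoin (mono_span A) f1) f2"
  proof (rule main[OF A])
    have "?u + ?v \<in> A"
      by (rule up_closed_on_add[OF A inA(2)])
    then show "f2 - monom5 ?x \<in> mono_span A"
      using inA(1) unfolding f2_def by (auto intro!: is_ideal_add[OF ideal[OF A]] simp: monom5_in_mono_span)
    show "regular_on (mono_span (A \<union> above ?x)) f1"
      unfolding f1_def by (rule regular_on_sum_34[OF up_closed_on_Un[OF A up_closed_on_above]]) simp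
  qed simp
  have regB: "regular_on (adjoin (mono_span B) f1) f2"
  proof (rule main[OF B])
    have "?v + ?u \<in> B"
      by (rule up_closed_on_add[OF B inB(2)])
    then have "monom5 ?x + monom5 (?v + ?u) \<in> (mono_span B :: 'k poly5 set)"
      using inB(1) by (intro is_ideal_add[OF ideal[OF B]]) (auto simp: monom5_in_mono_span)
    then show "f2 - monom5 ?y \<in> mono_span B"
      unfolding f2_def by (simp add: add.commute)
    show "regular_on (mono_span (B \<union> above ?y)) f1"
      unfolding f1_def by (rule regular_on_sum_34[OF up_closed_on_Un[OF B up_closed_on_above]]) simp
  qed simp
  have regC: "regular_on (adjoin (mono_span C) f1) f2"
  proof (rule main[OF C])
    show "f2 - monom5 (?u + ?v) \<in> mono_span C"
      using inC unfolding f2_def by (auto intro!: is_ideal_add[OF ideal[OF C]] simp: monom5_in_mono_span)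
    show "keys (?u + ?v) \<inter> {0, 1, 2} = {}"
      by (auto simp: in_keys_iff lookup_add lookup_single when_def)
    \<comment> \<open>\<open>C \<union> above (?u + ?v)\<close> involves both indices 3 and 4, but
      it is the intersection of two sets that each miss one of them.\<close>
    have "regular_on (mono_span (C \<union> above ?u)) f1" "regular_on (mono_span (C \<union> above ?v)) f1"
      unfolding f1_def
      by (rule regular_on_sum_34[OF up_closed_on_Un[OF C up_closed_on_above]]; simp)+
    then show "regular_on (mono_span (C \<union> above (?u + ?v))) f1"
      unfolding uv Un_Int_distrib mono_span_Int by (rule regular_on_Int)
  qed
  have "regular_on (mono_span (A \<union> C)) f1"
    unfolding f1_def by (rule regular_on_sum_34[OF up_closed_on_Un[OF A C]]) simp
  then have regAC: "regular_on (adjoin (mono_span (A \<inter> C)) f1) f2"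
    by (rule regular_on_adjoin_mono_span_Int[OF A C regA regC])
  have "regular_on (mono_span (B \<union> C)) f1"
    unfolding f1_def by (rule regular_on_sum_34[OF up_closed_on_Un[OF B C]]) simp
  then have regBC: "regular_on (adjoin (mono_span (B \<inter> C)) f1) f2"
    by (rule regular_on_adjoin_mono_span_Int[OF B C regB regC])
  \<comment> \<open>This is where connectedness enters: the ideals of \<open>A \<inter> C\<close>
    and \<open>B \<inter> C\<close> add up to that of \<open>C\<close>, on which \<open>f1\<close>
    is regular.\<close>
  have "(A \<inter> C) \<union> (B \<inter> C) = C" and ABC: "A \<inter> B \<inter> C = (A \<inter> C) \<inter> (B \<inter> C)"
    using sub by auto
  moreover have "regular_on (mono_span C) f1"
    unfolding f1_def by (rule regular_on_sum_34[OF C]) simp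
  ultimately have "regular_on (mono_span ((A \<inter> C) \<union> (B \<inter> C))) f1"
    by simp
  then show ?thesis
    unfolding ABC
    by (rule regular_on_adjoin_mono_span_Int[OF up_closed_on_Int[OF A C] up_closed_on_Int[OF B C] regAC regBC])
qed

section \<open>The exponent sets\<close>

lemma set_pow_add:
  fixes U :: "'a::comm_monoid_add set"
  assumes "a \<in> set_pow U s" "b \<in> set_pow U t" and up: "\<And>a b. a \<in> U \<Longrightarrow> a + b \<in> U"
  shows "a + b \<in> set_pow U (s + t)"
  using assms(1)
proof (induction s arbitrary: a)
  case 0
  \<comment> \<open>With \<open>set_pow U 0 = UNIV\<close>, the case of no factors says that
    \<open>set_pow U t\<close> absorbs arbitrary exponents.\<close>
  have "a + b \<in> set_pow U t" if "b \<in> set_pow U t" for a b t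
    using that
  proof (induction t arbitrary: b)
    case (Suc t)
    then obtain c d where "b = c + d" "c \<in> U" "d \<in> set_pow U t"
      by auto
    then have "a + b = (c + a) + d" "c + a \<in> U"
      using up[of c a] by (simp_all add: ac_simps)
    then show ?case
      using \<open>d \<in> set_pow U t\<close> by auto
  qed simp
  then show ?case
    using assms(2) by simp
next
  case (Suc s)
  then obtain c d where "a = c + d" "c \<in> U" "d \<in> set_pow U s"
    by auto
  then show ?case
    using Suc.IH[of d] by (auto simp: add.assoc)
qed

lemma sum_const_in_set_pow: "g \<in> U \<Longrightarrow> (\<Sum>i<t. g) \<in> set_pow U t"
  by (induction t) (auto simp: add.commute)

lemma lookup_sum_const: "lookup (\<Sum>i<t. g) j = t * lookup g j" for g :: "5 \<Rightarrow>\<^sub>0 nat"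
  by (induction t) (simp_all add: lookup_add del: sum_constant)

lemma single_mult_in_set_pow:
  assumes "Poly_Mapping.single i n \<in> U"
  shows "Poly_Mapping.single i (n * t) \<in> set_pow U t"
proof -
  have "Poly_Mapping.single i (n * t) = (\<Sum>j<t. Poly_Mapping.single i n)"
    by (intro poly_mapping_eqI) (auto simp: lookup_sum lookup_single when_def)
  then show ?thesis
    using sum_const_in_set_pow[OF assms] by simp
qed

definition side_exps :: "nat \<Rightarrow> 5 \<Rightarrow> 5 \<Rightarrow> 5 \<Rightarrow> (5 \<Rightarrow>\<^sub>0 nat) set" where
  "side_exps P i j k = {a. P \<le> lookup a i \<or> 2 \<le> lookup a j \<or> 1 \<le> lookup a k}"

lemma up_closed_on_side_exps: "up_closed_on {i, j, k} (side_exps P i j k)"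
  unfolding up_closed_on_def side_exps_def by (auto intro: le_trans)

text \<open>The generators are powers of distinct variables, so the largest number of them whose
  product divides a monomial is the sum of the separate quotients.\<close>

lemma set_pow_side_exps:
  assumes "P > 0" "i \<noteq> j" "i \<noteq> k" "j \<noteq> k"
  shows "set_pow (side_exps P i j k) t = {a. t \<le> lookup a i div P + lookup a j div 2 + lookup a k}"
proof (induction t)
  case (Suc t)
  have super: "x div n + y div n \<le> (x + y) div n" for x y n :: nat
    by (subst div_add1_eq) simp
  show ?case
  proof (intro equalityI subsetI)
    fix c assume "c \<in> set_pow (side_exps P i j k) (Suc t)"
    then obtain a b where ab: "c = a + b" "a \<in> side_exps P i j k"
      "t \<le> lookup b i div P + lookup b j div 2 + lookup b k"
      using Suc by auto
    have "1 \<le> lookup a i div P + lookup a j div 2 + lookup a k"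
    proof -
      have "P \<le> lookup a i \<Longrightarrow> 1 \<le> lookup a i div P"
        using assms(1) by (simp add: Suc_le_eq div_greater_zero_iff)
      moreover have "2 \<le> lookup a j \<Longrightarrow> 1 \<le> lookup a j div 2"
        by linarith
      ultimately show ?thesis
        using ab(2) unfolding side_exps_def by auto
    qed
    then show "c \<in> {a. Suc t \<le> lookup a i div P + lookup a j div 2 + lookup a k}"
      using ab(3) super[of "lookup a i" P "lookup b i"] super[of "lookup a j" 2 "lookup b j"]
      by (simp add: ab(1) lookup_add)
  next
    fix c assume c: "c \<in> {a. Suc t \<le> lookup a i div P + lookup a j div 2 + lookup a k}"
    have *: "c \<in> set_pow (side_exps P i j k) (Suc t)"
      if "Poly_Mapping.single l n \<in> side_exps P i j k" "n \<le> lookup c l"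
        "t \<le> lookup (c - Poly_Mapping.single l n) i div P
          + lookup (c - Poly_Mapping.single l n) j div 2 + lookup (c - Poly_Mapping.single l n) k" for l n
    proof -
      have "c = Poly_Mapping.single l n + (c - Poly_Mapping.single l n)"
        using that(2) by (intro poly_mapping_eqI) (auto simp: lookup_add lookup_minus lookup_single when_def)
      then show ?thesis
        using that(1,3) Suc by auto
    qed
    consider "P \<le> lookup c i" | "2 \<le> lookup c j" | "1 \<le> lookup c k"
    proof -
      have "lookup c i < P \<Longrightarrow> lookup c j < 2 \<Longrightarrow> lookup c k < 1 \<Longrightarrow> False"
        using c by simp
      then show thesis
        using that by (meson not_le)
    qed
    then show "c \<in> set_pow (side_exps P i j k) (Suc t)"
    proof cases
      case 1
      then have "lookup c i div P = Suc ((lookup c i - P) div P)"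
        using assms(1) by (simp add: le_div_geq)
      then show ?thesis
        using 1 c assms by (intro *[of i P]) (auto simp: side_exps_def lookup_minus lookup_single when_def)
    next
      case 2
      then have "lookup c j div 2 = Suc ((lookup c j - 2) div 2)"
        by (simp add: le_div_geq)
      then show ?thesis
        using 2 c assms by (intro *[of j 2]) (auto simp: side_exps_def lookup_minus lookup_single when_def)
    next
      case 3
      then show ?thesis
        using 3 c assms by (intro *[of k 1]) (auto simp: side_exps_def lookup_minus lookup_single when_def)
    qed
  qed
qed simp

text \<open>The three mixed generators are \<open>g1\<close>, \<open>g2\<close>, \<open>g3\<close> from the top of the file; \<open>D\<close> is the residue \<open>d\<close>,
  taken in \<open>{1..m}\<close> so that the window is also reached for small \<open>t\<close>.\<close>
definition mid_exps :: "nat \<Rightarrow> nat \<Rightarrow> (5 \<Rightarrow>\<^sub>0 nat) set" where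
  "mid_exps m D = {a. 8 * m \<le> lookup a 0 \<or> 8 * m \<le> lookup a 1 \<or> 4 \<le> lookup a 2
    \<or> m + 1 \<le> lookup a 0 \<and> 3 * m - 1 \<le> lookup a 1
    \<or> 2 * m + 1 \<le> lookup a 0 \<and> 2 * m - 1 \<le> lookup a 1
    \<or> 2 * m + 1 - D \<le> lookup a 0 \<and> m + D - 1 \<le> lookup a 1 \<and> 1 \<le> lookup a 2}"

lemma up_closed_on_mid_exps: "up_closed_on {0, 1, 2} (mid_exps m D)"
  unfolding up_closed_on_def mid_exps_def
  by (intro allI impI CollectI) (elim CollectE disjE; simp; linarith)

text \<open>\<open>h\<close> counts the factors from pure powers of \<open>x\<close> or
  \<open>y\<close>, \<open>h'\<close> those from \<open>z^4\<close>, and \<open>i\<close>,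
  \<open>k\<close>, \<open>l\<close> those from the three mixed generators. Pure powers of
  \<open>x\<close> and \<open>y\<close> are counted together, so \<open>h\<close> enters only
  through the total degree in \<open>x, y\<close>.\<close>

lemma set_pow_imp_generator_counts:
  assumes gens: "\<And>b. b \<in> U \<Longrightarrow> N \<le> lookup b 0 \<or> N \<le> lookup b 1 \<or> 4 \<le> lookup b 2
      \<or> p1 \<le> lookup b 0 \<and> q1 \<le> lookup b 1 \<or> p2 \<le> lookup b 0 \<and> q2 \<le> lookup b 1
      \<or> p3 \<le> lookup b 0 \<and> q3 \<le> lookup b 1 \<and> 1 \<le> lookup b 2"
    and "a \<in> set_pow U t"
  shows "\<exists>h h' i k l. h + h' + i + k + l = t
    \<and> i * p1 + k * p2 + l * p3 \<le> lookup a 0 \<and> i * q1 + k * q2 + l * q3 \<le> lookup a 1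
    \<and> i * (p1 + q1) + k * (p2 + q2) + l * (p3 + q3) + h * N \<le> lookup a 0 + lookup a 1
    \<and> 4 * h' + l \<le> lookup a (2::5)"
  using assms(2)
proof (induction t arbitrary: a)
  case 0
  then show ?case
    by (intro exI[of _ 0]) simp
next
  case (Suc t)
  then obtain b c where a: "a = b + c" "b \<in> U" "c \<in> set_pow U t"
    by auto
  from Suc.IH[OF a(3)] obtain h h' i k l where IH: "h + h' + i + k + l = t"
    "i * p1 + k * p2 + l * p3 \<le> lookup c 0" "i * q1 + k * q2 + l * q3 \<le> lookup c 1"
    "i * (p1 + q1) + k * (p2 + q2) + l * (p3 + q3) + h * N \<le> lookup c 0 + lookup c 1"
    "4 * h' + l \<le> lookup c 2"
    by blast
  note * = a(1) lookup_add
  from gens[OF a(2)] show ?case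
  proof (elim disjE)
    assume "N \<le> lookup b 0"
    with IH show ?thesis
      by - (rule exI[of _ "Suc h"], rule exI[of _ h'], rule exI[of _ i], rule exI[of _ k], rule exI[of _ l],
          simp add: *)
  next
    assume "N \<le> lookup b 1"
    with IH show ?thesis
      by - (rule exI[of _ "Suc h"], rule exI[of _ h'], rule exI[of _ i], rule exI[of _ k], rule exI[of _ l],
          simp add: *)
  next
    assume "4 \<le> lookup b 2"
    with IH show ?thesis
      by - (rule exI[of _ h], rule exI[of _ "Suc h'"], rule exI[of _ i], rule exI[of _ k], rule exI[of _ l],
          simp add: *)
  next
    assume "p1 \<le> lookup b 0 \<and> q1 \<le> lookup b 1"
    with IH show ?thesis
      by - (rule exI[of _ h], rule exI[of _ h'], rule exI[of _ "Suc i"], rule exI[of _ k], rule exI[of _ l],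
          simp add: *)
  next
    assume "p2 \<le> lookup b 0 \<and> q2 \<le> lookup b 1"
    with IH show ?thesis
      by - (rule exI[of _ h], rule exI[of _ h'], rule exI[of _ i], rule exI[of _ "Suc k"], rule exI[of _ l],
          simp add: *)
  next
    assume "p3 \<le> lookup b 0 \<and> q3 \<le> lookup b 1 \<and> 1 \<le> lookup b 2"
    with IH show ?thesis
      by - (rule exI[of _ h], rule exI[of _ h'], rule exI[of _ i], rule exI[of _ k], rule exI[of _ "Suc l"],
          simp add: *)
  qed
qed

lemma set_pow_mid_expsD:
  assumes "m \<ge> 1" "a \<in> set_pow (mid_exps m D) t"
  shows "\<exists>h h' i k l. h + h' + i + k + l = t
    \<and> i * (m + 1) + k * (2 * m + 1) + l * (2 * m + 1 - D) \<le> lookup a 0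
    \<and> i * (3 * m - 1) + k * (2 * m - 1) + l * (m + D - 1) \<le> lookup a 1
    \<and> i * (4 * m) + k * (4 * m) + l * (2 * m + 1 - D + (m + D - 1)) + h * (8 * m) \<le> lookup a 0 + lookup a 1
    \<and> 4 * h' + l \<le> lookup a 2"
proof -
  have "m + 1 + (3 * m - 1) = 4 * m" "2 * m + 1 + (2 * m - 1) = 4 * m"
    using assms(1) by auto
  then show ?thesis
    using set_pow_imp_generator_counts[OF _ assms(2), of "8 * m" "m + 1" "3 * m - 1" "2 * m + 1" "2 * m - 1"
        "2 * m + 1 - D" "m + D - 1"]
    unfolding mid_exps_def by (simp only: mem_Collect_eq)
qed

text \<open>With \<open>i + k + 1 = t\<close> the inequalities say
  \<open>D - m < t - m * i < D\<close> over the integers. The only residue class modulo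
  \<open>m\<close> without a member in this window is that of \<open>D\<close>.\<close>

lemma window_exists:
  fixes m D t :: nat
  assumes "m \<ge> 2" "1 \<le> D" "D \<le> m" "t \<ge> 1" "t mod m \<noteq> D mod m"
  obtains i k where "i + k + 1 = t" "k + 1 < (m - 1) * i + D" "(m - 1) * i + D < k + m + 1"
proof -
  define q r where "q = (t - 1) div m" and "r = (t - 1) mod m"
  have t: "t = q * m + r + 1"
    using assms(4) by (simp add: q_def r_def)
  have r: "r < m"
    using assms(1) by (simp add: r_def)
  have "r + 1 \<noteq> D"
    using assms(5) by (auto simp: t add.assoc)
  obtain n where m: "m = n + 1"
    using assms(1) by (metis add.commute le_add_diff_inverse one_le_numeral order_trans)
  consider "r + 2 \<le> D" | "D \<le> r"
    using \<open>r + 1 \<noteq> D\<close> by linarith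
  then show thesis
  proof cases
    case 1
    then show thesis
      using r assms(3) by (intro that[of q "q * n + r"]) (auto simp: t m algebra_simps)
  next
    \<comment> \<open>Here \<open>r \<ge> D \<ge> 1\<close>, so the subtraction in the witness for
      \<open>k\<close> is exact.\<close>
    case 2
    then show thesis
      using r assms(2) by (intro that[of "q + 1" "q * n + r - 1"]) (auto simp: t m algebra_simps)
  qed
qed

text \<open>The inequalities put \<open>m * i + D - t\<close> strictly between 0 and
  \<open>m\<close>, so \<open>m\<close> does not divide it.\<close>

lemma window_imp_mod_neq:
  fixes m D t :: nat
  assumes "i + k + 1 = t" "k + 1 < (m - 1) * i + D" "(m - 1) * i + D < k + m + 1" "m \<ge> 2"
  shows "t mod m \<noteq> D mod m"
proof
  assume "t mod m = D mod m"
  then have "int m dvd int t - int D"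
    by (metis mod_eq_dvd_iff zmod_int)
  then have dvd: "int m dvd int t - int D - int m * int i"
    by simp
  have "(m - 1) * i + i = m * i"
    using assms(4) by (cases m) auto
  then have "k + 1 + i < m * i + D" "m * i + D < k + m + 1 + i"
    using assms(2,3) by linarith+
  then have "0 < int m * int i + int D - int t" "int m * int i + int D - int t < int m"
    using assms(1) by (simp_all flip: of_nat_mult)
  moreover have "int m dvd int m * int i + int D - int t"
    using dvd_minus_iff[of "int m" "int t - int D - int m * int i"] dvd by (simp add: algebra_simps)
  ultimately show False
    using zdvd_not_zless by blast
qed

lemma single_in_mid_exps:
  "Poly_Mapping.single 0 (8 * m) \<in> mid_exps m D" "Poly_Mapping.single 1 (8 * m) \<in> mid_exps m D"
  "Poly_Mapping.single 2 4 \<in> mid_exps m D"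
  by (auto simp: mid_exps_def)

lemma mid_exps_pow_subset:
  assumes "m \<ge> 2" "1 \<le> D" "D \<le> m" "t mod m = D mod m"
  shows "set_pow (mid_exps m D) t
    \<subseteq> set_pow (side_exps (2 * m) 1 2 3) t \<union> set_pow (side_exps (2 * m) 0 2 4) t"
proof (rule subsetI, rule ccontr)
  fix a assume a: "a \<in> set_pow (mid_exps m D) t"
    "a \<notin> set_pow (side_exps (2 * m) 1 2 3) t \<union> set_pow (side_exps (2 * m) 0 2 4) t"
  \<comment> \<open>\<open>c\<close> is the number of factors \<open>z^2\<close>, which count
    towards both side components; \<open>w = t - c\<close> factors remain to be refused by the
    powers of \<open>x\<close> and of \<open>y\<close>.\<close>
  define c where "c = lookup a 2 div 2"
  have "lookup a 1 div (2 * m) + c < t" "lookup a 0 div (2 * m) + c < t"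
    using a(2) assms(1) by (auto simp: set_pow_side_exps c_def)
  then have "lookup a 1 div (2 * m) < t - c" "lookup a 0 div (2 * m) < t - c" "c < t"
    by auto
  then have lt: "lookup a 1 < (t - c) * (2 * m)" "lookup a 0 < (t - c) * (2 * m)" and "c < t"
    using assms(1) by (auto simp: div_less_iff_less_mult)
  obtain h h' i k l where t: "h + h' + i + k + l = t"
    and x: "i * (m + 1) + k * (2 * m + 1) + l * (2 * m + 1 - D) \<le> lookup a 0"
    and y: "i * (3 * m - 1) + k * (2 * m - 1) + l * (m + D - 1) \<le> lookup a 1"
    and xy: "i * (4 * m) + k * (4 * m) + l * (2 * m + 1 - D + (m + D - 1)) + h * (8 * m)
      \<le> lookup a 0 + lookup a 1"
    and z: "4 * h' + l \<le> lookup a 2"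
    using set_pow_mid_expsD[OF _ a(1)] assms(1) by auto
  obtain q where q: "c = 2 * h' + l div 2 + q"
  proof -
    have "2 * h' + l div 2 \<le> c"
      using z unfolding c_def by linarith
    then show thesis
      using that le_Suc_ex by blast
  qed
  obtain w where w: "t = c + w"
    using \<open>c < t\<close> less_imp_add_positive by blast
  have "2 * m + 1 - D + (m + D - 1) = 3 * m"
    using assms by auto
  then have "i * (4 * m) + k * (4 * m) + l * (3 * m) + h * (8 * m) < w * (4 * m)"
    using lt xy w by simp
  then have "m * (4 * i + 4 * k + 3 * l + 8 * h) < m * (4 * w)"
    by (simp add: algebra_simps)
  then have "4 * i + 4 * k + 3 * l + 8 * h < 4 * w"
    by simp
  \<comment> \<open>Only \<open>g3\<close> has degree below \<open>4 * m\<close> in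
    \<open>x, y\<close>, namely \<open>3 * m\<close>; already two factors \<open>g3\<close> lose
    more through \<open>z^2\<close> than they save.\<close>
  then have "4 * h + 4 * h' + 4 * (l div 2) < l"
    using t w q by linarith
  moreover have "l < 2 * (l div 2) + 2"
    by linarith
  ultimately have l: "l = 1" "h = 0" "h' = 0"
    by linarith+
  have "w \<le> t"
    using w by simp
  then have "w * (2 * m) \<le> t * (2 * m)"
    by (rule mult_le_mono1)
  then have lt': "lookup a 1 < t * (2 * m)" "lookup a 0 < t * (2 * m)"
    using lt w by (metis add_diff_cancel_left' less_le_trans)+
  have t': "t = i + k + 1"
    using t l by simp
  obtain n where m: "m = n + 1"
    using assms(1) by (metis add.commute le_add_diff_inverse one_le_numeral order_trans)
  \<comment> \<open>Relative to \<open>2 * m\<close> in each variable, \<open>g1\<close> has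
    \<open>m - 1\<close> less in \<open>x\<close> and more in \<open>y\<close>, and
    \<open>g2\<close> has 1 more in \<open>x\<close> and less in \<open>y\<close>; the bounds on
    \<open>x\<close> and \<open>y\<close> become the two ends of the window.\<close>
  have "k + 1 < (m - 1) * i + D"
    using x lt'(2) assms(3) unfolding t' l m by (simp add: algebra_simps)
  moreover have "(m - 1) * i + D < k + m + 1"
    using y lt'(1) assms(2) unfolding t' l m by (simp add: algebra_simps)
  ultimately show False
    using window_imp_mod_neq[of i k t m D] t' assms(1,4) by simp
qed

text \<open>The witness is the exponent of \<open>g1^i g2^k g3\<close> with \<open>i\<close>,
  \<open>k\<close> from the window; its single factor \<open>z\<close> contributes nothing to the
  quotient by 2.\<close>

lemma mid_exps_pow_not_subset:
  assumes "m \<ge> 2" "1 \<le> D" "D \<le> m" "t \<ge> 1" "t mod m \<noteq> D mod m"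
  obtains a where "a \<in> set_pow (mid_exps m D) t"
    "a \<notin> set_pow (side_exps (2 * m) 1 2 3) t" "a \<notin> set_pow (side_exps (2 * m) 0 2 4) t"
proof -
  obtain i k where ik: "i + k + 1 = t" "k + 1 < (m - 1) * i + D" "(m - 1) * i + D < k + m + 1"
    using window_exists[OF assms] by blast
  define e :: "nat \<Rightarrow> nat \<Rightarrow> nat \<Rightarrow> 5 \<Rightarrow>\<^sub>0 nat" where
    "e x y z = Poly_Mapping.single 0 x + Poly_Mapping.single 1 y + Poly_Mapping.single 2 z" for x y z
  have e: "lookup (e x y z) 0 = x" "lookup (e x y z) 1 = y" "lookup (e x y z) 2 = z"
    "lookup (e x y z) 3 = 0" "lookup (e x y z) 4 = 0" for x y z
    by (auto simp: e_def lookup_add lookup_single when_def)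
  define g1 g2 g3 where "g1 = e (m + 1) (3 * m - 1) 0" and "g2 = e (2 * m + 1) (2 * m - 1) 0"
    and "g3 = e (2 * m + 1 - D) (m + D - 1) 1"
  have g: "g1 \<in> mid_exps m D" "g2 \<in> mid_exps m D" "g3 \<in> mid_exps m D"
    by (auto simp: mid_exps_def g1_def g2_def g3_def e)
  define a where "a = (\<Sum>j<i. g1) + ((\<Sum>j<k. g2) + (\<Sum>j<1::nat. g3))"
  have "a \<in> set_pow (mid_exps m D) (i + (k + 1))"
    unfolding a_def
    by (intro set_pow_add sum_const_in_set_pow g up_closed_on_add[OF up_closed_on_mid_exps])
  moreover have "i + (k + 1) = t"
    using ik(1) by simp
  ultimately have 1: "a \<in> set_pow (mid_exps m D) t"
    by (simp only:)
  obtain n where m: "m = n + 1"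
    using assms(1) by (metis add.commute le_add_diff_inverse one_le_numeral order_trans)
  have "lookup a 0 = i * (m + 1) + (k * (2 * m + 1) + (2 * m + 1 - D))"
    "lookup a 1 = i * (3 * m - 1) + (k * (2 * m - 1) + (m + D - 1))"
    and a2: "lookup a 2 = 1" "lookup a 3 = 0" "lookup a 4 = 0"
    unfolding a_def g1_def g2_def g3_def by (simp_all add: lookup_add lookup_sum_const e del: sum_constant)
  then have "lookup a 0 < t * (2 * m)" "lookup a 1 < t * (2 * m)"
    using ik assms(2,3) unfolding ik(1)[symmetric] m by (auto simp: algebra_simps)
  then have "lookup a 0 div (2 * m) < t" "lookup a 1 div (2 * m) < t"
    using assms(1) by (auto simp: div_less_iff_less_mult)
  then show thesis
    using assms(1) a2 by (intro that[OF 1]) (auto simp: set_pow_side_exps)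
qed

section \<open>The symbolic powers of the ideal and their depth\<close>

lemma zero_notin_side_exps: "P > 0 \<Longrightarrow> 0 \<notin> side_exps P i j k"
  by (simp add: side_exps_def)

lemma zero_notin_mid_exps: "m \<ge> 1 \<Longrightarrow> 0 \<notin> mid_exps m D"
  by (simp add: mid_exps_def)

lemma symbolic_power_side_mid:
  fixes m D t :: nat
  assumes m: "m \<ge> 1"
  shows "symbolic_power (mono_span (side_exps (2 * m) 1 2 3 \<inter> side_exps (2 * m) 0 2 4 \<inter> mid_exps m D)) t
    = (mono_span (set_pow (side_exps (2 * m) 1 2 3) t \<inter> set_pow (side_exps (2 * m) 0 2 4) t
        \<inter> set_pow (mid_exps m D) t) :: 'k::field poly5 set)"
proof -
  define F :: "nat \<Rightarrow> 5 set" where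
    "F j = (if j = 0 then {1, 2, 3} else if j = 1 then {0, 2, 4} else {0, 1, 2})" for j
  define U where
    "U j = (if j = 0 then side_exps (2 * m) 1 2 3 else if j = 1 then side_exps (2 * m) 0 2 4
      else mid_exps m D)" for j :: nat
  have "symbolic_power (mono_span (\<Inter>j\<in>{0, 1, 2}. U j)) t
      = (mono_span (\<Inter>j\<in>{0, 1, 2}. set_pow (U j) t) :: 'k poly5 set)"
  proof (rule symbolic_power_primary_Inter[where F = F])
    show "up_closed_on (F j) (U j)" for j
      by (auto simp: F_def U_def up_closed_on_side_exps up_closed_on_mid_exps)
    show "0 \<notin> U j" for j
      using m by (auto simp: U_def zero_notin_side_exps zero_notin_mid_exps)
    show "\<exists>n. Poly_Mapping.single i n \<in> U j" if "i \<in> F j" for i j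
    proof -
      \<comment> \<open>An exponent large enough for every variable of every component.\<close>
      have "Poly_Mapping.single i (8 * m + 4) \<in> U j"
        using that by (auto simp: F_def U_def side_exps_def mid_exps_def split: if_splits)
      then show ?thesis ..
    qed
    show "j = j'" if "j \<in> {0, 1, 2}" "j' \<in> {0, 1, 2}" "F j \<subseteq> F j'" for j j'
      using that by (auto simp: F_def split: if_splits)
  qed simp
  then show ?thesis
    by (simp add: U_def Int_ac)
qed

lemma depth_quot_side_mid:
  fixes m D t :: nat
  assumes m: "m \<ge> 2" and D: "1 \<le> D" "D \<le> m" and t: "t \<ge> 1"
  shows "depth_quot (mono_span (set_pow (side_exps (2 * m) 1 2 3) t \<inter> set_pow (side_exps (2 * m) 0 2 4) t
        \<inter> set_pow (mid_exps m D) t) :: 'k::field poly5 set)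
    = (if t mod m = D mod m then 2 else 1)"
proof -
  define A where "A = set_pow (side_exps (2 * m) 1 2 3) t"
  define B where "B = set_pow (side_exps (2 * m) 0 2 4) t"
  define C where "C = set_pow (mid_exps m D) t"
  define I :: "'k poly5 set" where "I = mono_span (A \<inter> B \<inter> C)"
  \<comment> \<open>Large enough for the pure powers needed in the \<open>t\<close>-th powers of all
    three components.\<close>
  define N where "N = 8 * m * t"
  have N: "N > 0"
    using m t by (simp add: N_def)
  have A_eq: "A = {a. t \<le> lookup a 1 div (2 * m) + lookup a 2 div 2 + lookup a 3}"
    and B_eq: "B = {a. t \<le> lookup a 0 div (2 * m) + lookup a 2 div 2 + lookup a 4}"
    unfolding A_def B_def using m by (simp_all add: set_pow_side_exps)
  have A: "up_closed_on {1, 2, 3} A" and B: "up_closed_on {0, 2, 4} B" and C: "up_closed_on {0, 1, 2} C"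
    unfolding A_def B_def C_def
    by (rule up_closed_on_set_pow up_closed_on_side_exps up_closed_on_mid_exps)+
  have AB: "up_closed_on UNIV (A \<inter> B)"
    using up_closed_on_Int[OF A B] by (rule up_closed_on_subset) simp
  have ABC: "up_closed_on UNIV (A \<inter> B \<inter> C)"
    using up_closed_on_Int[OF AB C] by simp
  have I: "is_ideal I"
    unfolding I_def by (rule is_ideal_mono_span[OF ABC])
  have sub: "I \<subseteq> max_hom"
    unfolding I_def using t by (intro mono_span_subset_max_hom) (simp add: A_eq)
  have inC: "Poly_Mapping.single 0 N \<in> C" "Poly_Mapping.single 1 N \<in> C"
    "Poly_Mapping.single 2 (4 * t) \<in> C"
    unfolding C_def N_def by (intro single_mult_in_set_pow single_in_mid_exps)+
  have "N div (2 * m) = 4 * t"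
  proof -
    have "N = 4 * t * (2 * m)"
      by (simp add: N_def)
    then show ?thesis
      using m by simp
  qed
  moreover have "t \<le> N"
    using m by (simp add: N_def)
  ultimately have inA: "Poly_Mapping.single 1 N \<in> A" "Poly_Mapping.single 3 N \<in> A"
    and inB: "Poly_Mapping.single 0 N \<in> B" "Poly_Mapping.single 4 N \<in> B"
    unfolding A_eq B_eq by auto
  \<comment> \<open>The zero sets of the two side components meet only in the origin.\<close>
  have boundedAB: "(\<Sum>i\<in>UNIV. lookup b i) < 4 * m * t + 4 * t" if "b \<notin> A" "b \<notin> B" for b
  proof -
    have "lookup b 1 div (2 * m) < t" "lookup b 0 div (2 * m) < t"
      and *: "lookup b 2 div 2 < t" "lookup b 3 < t" "lookup b 4 < t"
      using that by (auto simp: A_eq B_eq)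
    then have "lookup b 1 < 2 * (m * t)" "lookup b 0 < 2 * (m * t)"
      using m by (auto simp: div_less_iff_less_mult ac_simps)
    moreover have "lookup b 2 < 2 * t"
      using * by linarith
    moreover have "4 * m * t = 2 * (m * t) + 2 * (m * t)"
      by simp
    ultimately show ?thesis
      unfolding sum_UNIV_5 using * by linarith
  qed
  have boundedC: "lookup b 0 + lookup b 1 + lookup b 2 < 2 * N + 4 * t" if "b \<notin> C" for b
  proof -
    have "lookup b i < n" if "Poly_Mapping.single i n \<in> C" for i n
    proof (rule ccontr)
      assume "\<not> lookup b i < n"
      then have "b \<in> C"
        by (intro up_closed_onD[OF C that]) (auto simp: lookup_single when_def)
      then show False
        using \<open>b \<notin> C\<close> by simp
    qed
    from this[OF inC(1)] this[OF inC(2)] this[OF inC(3)] show ?thesis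
      by simp
  qed
  define f1 where "f1 = (var5 3 + var5 4 :: 'k poly5)"
  have f1: "f1 \<in> max_hom"
    unfolding f1_def
    by (intro is_ideal_add[OF is_ideal_max_hom]) (auto simp: max_hom_eq var5_in_face_prime)
  have reg1: "regular_on I f1"
    unfolding I_def f1_def mono_span_Int
    by (intro regular_on_Int regular_on_sum_34[OF A] regular_on_sum_34[OF B] regular_on_sum_34[OF C]) auto
  show ?thesis
  proof (cases "t mod m = D mod m")
    case True
    define f2 where "f2 = (monom5 (Poly_Mapping.single 0 N) + monom5 (Poly_Mapping.single 1 N)
      + monom5 (Poly_Mapping.single 3 N + Poly_Mapping.single 4 N) :: 'k poly5)"
    have "C \<subseteq> A \<union> B"
      unfolding A_def B_def C_def by (rule mid_exps_pow_subset[OF m D True])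
    then have "regular_on (adjoin I f1) f2"
      unfolding I_def f1_def f2_def using inA inB inC N by (intro regular_pair_if_connected A B C)
    moreover have "f2 \<in> max_hom"
      unfolding f2_def using N
      by (intro is_ideal_add[OF is_ideal_max_hom])
        (auto simp: monom5_in_max_hom exponent_neq_0_iff lookup_add lookup_single when_def)
    ultimately have "regular_seq I [f1, f2]"
      by (intro regular_seq_pairI I sub f1 reg1)
    moreover have "length gs \<le> 2" if "regular_seq I gs" for gs
    proof (rule ccontr)
      assume "\<not> length gs \<le> 2"
      then have len: "1 \<le> length gs" "2 \<le> length gs" "3 \<le> length gs"
        by auto
      \<comment> \<open>\<open>b\<close> takes \<open>t - 1\<close> factors from
        \<open>x^(2m)\<close> or \<open>y^(2m)\<close> and one from \<open>z^2\<close>, so it lies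
        in \<open>A \<inter> B\<close>. Its degree in \<open>x, y\<close> is \<open>4 * m\<close>
        short of \<open>t\<close> full factors, and \<open>z^2\<close> allows at most two factors
        \<open>g3\<close>, saving \<open>m\<close> each.\<close>
      define b :: "5 \<Rightarrow>\<^sub>0 nat" where "b = Poly_Mapping.single 0 (2 * m * (t - 1))
        + Poly_Mapping.single 1 (2 * m * (t - 1)) + Poly_Mapping.single 2 2"
      have b: "lookup b 0 = 2 * m * (t - 1)" "lookup b 1 = 2 * m * (t - 1)" "lookup b 2 = 2"
        "lookup b 3 = 0" "lookup b 4 = 0"
        by (auto simp: b_def lookup_add lookup_single when_def)
      have "b \<in> A \<inter> B"
        using m by (simp add: A_eq B_eq b)
      moreover have "b \<notin> C"
      proof
        assume "b \<in> C"
        then obtain h h' i k l where t': "h + h' + i + k + l = t"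
          and xy: "i * (4 * m) + k * (4 * m) + l * (2 * m + 1 - D + (m + D - 1)) + h * (8 * m)
            \<le> lookup b 0 + lookup b 1"
          and z: "4 * h' + l \<le> lookup b 2"
          using set_pow_mid_expsD[of m b D t] m unfolding C_def by auto
        have "2 * m + 1 - D + (m + D - 1) = 3 * m"
          using D by auto
        then have "m * (4 * i + 4 * k + 3 * l + 8 * h) \<le> m * (4 * (t - 1))"
          using xy by (simp add: b algebra_simps)
        then have "4 * i + 4 * k + 3 * l + 8 * h \<le> 4 * (t - 1)"
          using m by simp
        then show False
          using t t' z b(3) by linarith
      qed
      moreover have "gs ! 0 \<in> max_hom" "gs ! 1 \<in> max_hom" "gs ! 2 \<in> max_hom"
        by (rule regular_seq_nthD(4)[OF I that]; use len in linarith)+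
      ultimately show False
        using len regular_seq_nthD(1-3)[OF I that] unfolding I_def
        by (intro not_regular_triple[OF AB C, of b "2 * N + 4 * t" "gs ! 0" "gs ! 1" "gs ! 2"])
          (auto simp: b boundedC)
    qed
    ultimately have "depth_quot I = enat 2"
      by (intro depth_quot_eqI[of I "[f1, f2]"]) auto
    then show ?thesis
      using True by (simp add: I_def A_def B_def C_def numeral_eq_enat)
  next
    case False
    obtain a where a: "a \<in> C" "a \<notin> A" "a \<notin> B"
      unfolding A_def B_def C_def using mid_exps_pow_not_subset[OF m D t False] by blast
    have "length gs \<le> 1" if "regular_seq I gs" for gs
    proof (rule ccontr)
      assume "\<not> length gs \<le> 1"
      then have len: "1 \<le> length gs" "2 \<le> length gs"
        by auto
      show False
      proof (rule not_regular_pair_if_disconnected[OF A B C a(2,3,1) boundedAB])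
        show "Poly_Mapping.single 0 N \<in> B \<inter> C" "Poly_Mapping.single 1 N \<in> A \<inter> C"
          using inA inB inC by auto
        show "regular_on (mono_span (A \<inter> B \<inter> C)) (gs ! 0)"
          "regular_on (adjoin (mono_span (A \<inter> B \<inter> C)) (gs ! 0)) (gs ! 1)"
          using len regular_seq_nthD(1,2)[OF I that] unfolding I_def by auto
        show "gs ! 0 \<in> max_hom" "gs ! 1 \<in> max_hom"
          by (rule regular_seq_nthD(4)[OF I that]; use len in linarith)+
      qed (auto simp: lookup_single when_def)
    qed
    moreover have "regular_seq I [f1]"
      by (intro regular_seq_singleI I sub f1 reg1)
    ultimately have "depth_quot I = enat 1"
      by (intro depth_quot_eqI[of I "[f1]"]) auto
    then show ?thesis
      using False by (simp add: I_def A_def B_def C_def one_enat_def)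
  qed
qed

theorem theorem4p4:
  fixes m d :: nat
  assumes "m \<ge> 2" and "d < m"
  shows "\<exists>K :: 'k::field poly5 set. monomial_ideal K \<and>
           (\<forall>t \<ge> 1. depth_quot (symbolic_power K t) =
                       (if t mod m = d then 2 else 1))"
proof -
  define D where "D = (if d = 0 then m else d)"
  have D: "1 \<le> D" "D \<le> m" "D mod m = d"
    using assms by (auto simp: D_def)
  define W where "W = side_exps (2 * m) 1 2 3 \<inter> side_exps (2 * m) 0 2 4 \<inter> mid_exps m D"
  have W: "up_closed_on ({1, 2, 3} \<union> {0, 2, 4} \<union> {0, 1, 2}) W"
    unfolding W_def by (intro up_closed_on_Int up_closed_on_side_exps up_closed_on_mid_exps)
  have "monomial_ideal (mono_span W :: 'k poly5 set)"
    unfolding monomial_ideal_def using mono_span_eq_ideal_gen[OF W] by blast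
  moreover have "depth_quot (symbolic_power (mono_span W :: 'k poly5 set) t)
      = (if t mod m = d then 2 else 1)" if "t \<ge> 1" for t
    using assms(1) depth_quot_side_mid[OF assms(1) D(1,2) that, where 'k = 'k]
    unfolding W_def by (simp add: symbolic_power_side_mid D(3))
  ultimately show ?thesis
    by blast
qed

end
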